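(* Let $k\ge 1$ be an integer and let $G$ be a finite abelian group with primary decomposition $G\cong\bigoplus_i (\mathbb{Z}_{p_i^{r_i}})^{d_i}$, where the pairs $(p_i,r_i)$ are pairwise distinct and $d_i\ge1$. Suppose there is an index $i$ with $d_i=1$ (i.e. a cyclic summand $\mathbb{Z}_{p^{r}}$, $p=p_i$, $r=r_i$, of multiplicity one) such that either $p=2$ (and $k$ arbitrary), or $p=3$ and $k$ is odd. Then the restricted wreath product $G\wr\mathbb{Z}^k$ has the $R_\infty$ property, i.e. every automorphism $\varphi$ of $G\wr\mathbb{Z}^k$ has infinite Reidemeister number $R(\varphi)=\infty$.
   Context: For a group $\Gamma$ and an automorphism $\varphi:\Gamma\to\Gamma$, the Reidemeister (twisted conjugacy) classes of $\varphi$ are the classes of the equivalence relation $x\sim gx\varphi(g^{-1})$ ($g\in\Gamma$), and the Reidemeister number $R(\varphi)$ is the number of these classes (possibly infinite). A group has the $R_\infty$ property if every automorphism of it has $R(\varphi)=\infty$. The restricted wreath product $G\wr\mathbb{Z}^k$ is the semidirect product $\Sigma\rtimes_\alpha\mathbb{Z}^k$, where $\Sigma=\bigoplus_{x\in\mathbb{Z}^k}G_x$ is the direct sum of copies $G_x\cong G$ and $\mathbb{Z}^k$ acts by shifting indices: $\alpha(x)(g_y)=g_{x+y}$. *)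

theory Defs
  imports "HOL-Algebra.Algebra" "HOL-Computational_Algebra.Primes"
begin

definition lattice :: "nat \<Rightarrow> (nat \<Rightarrow> int) set" where
  "lattice k = {x. \<forall>i\<ge>k. x i = 0}"

text \<open>Restricted wreath product G wr Z^k = Sigma semidirect Z^k, where Sigma is the direct sum
  (finitely supported functions) of copies G_x, x in Z^k, and Z^k acts by shifting indices:
  the action of x moves the entry at position y to position x + y.
  Multiplication: (f,x)(g,y) = (f * alpha(x) g, x + y) with (alpha(x) g)(z) = g(z - x).\<close>
definition wreath_Zk :: "('a, 'b) monoid_scheme \<Rightarrow> nat \<Rightarrow> (((nat \<Rightarrow> int) \<Rightarrow> 'a) \<times> (nat \<Rightarrow> int)) monoid" where
  "wreath_Zk G k = \<lparr>carrier = {(f, x). x \<in> lattice k \<and> (\<forall>y. f y \<in> carrier G)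
                                 \<and> finite {y. f y \<noteq> \<one>\<^bsub>G\<^esub>} \<and> (\<forall>y. y \<notin> lattice k \<longrightarrow> f y = \<one>\<^bsub>G\<^esub>)},
                    monoid.mult = (\<lambda>(f, x) (g, y). (\<lambda>z. f z \<otimes>\<^bsub>G\<^esub> g (\<lambda>i. z i - x i), \<lambda>i. x i + y i)),
                    one = (\<lambda>_. \<one>\<^bsub>G\<^esub>, \<lambda>_. 0)\<rparr>"

definition twisted_conj :: "('a, 'b) monoid_scheme \<Rightarrow> ('a \<Rightarrow> 'a) \<Rightarrow> ('a \<times> 'a) set" where
  "twisted_conj G \<phi> = {(x, y). x \<in> carrier G \<and> y \<in> carrier G \<and>
      (\<exists>g\<in>carrier G. y = g \<otimes>\<^bsub>G\<^esub> x \<otimes>\<^bsub>G\<^esub> inv\<^bsub>G\<^esub> (\<phi> g))}"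

definition reidemeister_classes :: "('a, 'b) monoid_scheme \<Rightarrow> ('a \<Rightarrow> 'a) \<Rightarrow> 'a set set" where
  "reidemeister_classes G \<phi> = carrier G // twisted_conj G \<phi>"

definition R_infty :: "('a, 'b) monoid_scheme \<Rightarrow> bool" where
  "R_infty G \<longleftrightarrow> (\<forall>\<phi> \<in> iso G G. infinite (reidemeister_classes G \<phi>))"

end

theory Submission
  imports Defs "HOL-Library.Function_Algebras" "HOL-Number_Theory.Cong" "Jordan_Normal_Form.Char_Poly"
begin

text \<open>
  An automorphism \<open>\<phi>\<close> of \<open>G \<wr> \<int>\<^sup>k\<close> preserves the torsion subgroup \<open>\<Sigma>\<close> and induces \<open>A \<in> GL(k, \<int>)\<close>
  on the quotient. If \<open>R(\<phi>)\<close> is finite, then \<open>1 - A\<close> has finite cokernel, so it is injective.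
  Multiplicity one makes the Ulm factor \<open>P\<Sigma> / Q\<Sigma>\<close>, with \<open>P = p\<^bsup>r-1\<^esup>G \<inter> G[p]\<close> and \<open>Q = p\<^bsup>r\<^esup>G \<inter> G[p]\<close>,
  a free module of rank one over \<open>F\<^sub>p[\<int>\<^sup>k]\<close>. This ring has only monomial units, so \<open>\<phi>\<close> acts there as
  \<open>t\<^bsup>x\<^esup> \<mapsto> c t\<^bsup>Ax+m\<^esup>\<close> with \<open>c = 1\<close> or, for \<open>p = 3\<close>, \<open>c = \<plusminus>1\<close>. Composing with the inner automorphism of
  \<open>-m\<close> gives \<open>m = 0\<close>.

  Functions \<open>v\<close> on \<open>\<int>\<^sup>k\<close> with \<open>c v(A x) = v(x)\<close> then yield invariant functionals on the Ulm factor. For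
  \<open>c = 1\<close> take the indicator of the nonzero classes modulo 2. For \<open>c = -1\<close> take an alternating function
  on an \<open>A\<close>-orbit of even length modulo some \<open>2\<^bsup>e\<^esup>\<close>: if there were none, then \<open>A\<^bsup>h\<^esup> = 1\<close> for an odd \<open>h\<close>,
  and since \<open>k\<close> is odd, \<open>A\<close> would have a real eigenvalue, necessarily 1. Rescaling \<open>v\<close> produces
  arbitrarily many functionals, all periodic modulo some \<open>N\<close>. The \<open>N\<close>-periodic characters of \<open>\<Sigma>\<close> form
  a finite group, where an endomorphism has at least as many fixed points as on any invariant
  subquotient. So \<open>\<Sigma>\<close> itself has arbitrarily many invariant characters, whereas each of them is
  determined by its values on the finitely many twisted conjugacy classes.
\<close>

section \<open>Endomorphisms of \<open>\<int>\<^sup>k\<close>\<close>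

text \<open>The intermediate value theorem applies once both signs occur; passing from
  \<open>p\<close> to \<open>- p\<close> reduces to a positive leading coefficient.\<close>

lemma odd_degree_real_root:
  fixes p :: "real poly"
  assumes "odd (degree p)"
  shows "\<exists>x. poly p x = 0"
proof -
  have pos: "\<exists>x. poly q x = 0" if q: "odd (degree q)" "lead_coeff q > 0" for q :: "real poly"
  proof -
    \<comment> \<open>This is the polynomial \<open>- q (- x)\<close>. As the degree is odd, it has
      the same leading coefficient as \<open>q\<close>, so growth at plus infinity settles both ends
      of the line.\<close>
    define q' where "q' = - pcompose q [:0, - 1:]"
    have deg: "degree q' = degree q"
      by (simp add: q'_def degree_pcompose)
    have "lead_coeff (pcompose q [:0, - 1:]) = lead_coeff q * (- 1) ^ degree q"
      by (subst lead_coeff_comp) auto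
    then have lc: "lead_coeff q' = lead_coeff q"
      using q by (simp add: q'_def)
    obtain a where a: "\<And>x. x \<ge> a \<Longrightarrow> poly q x \<ge> lead_coeff q"
      using poly_pinfty_gt_lc[OF q(2)] by blast
    obtain b where b: "\<And>x. x \<ge> b \<Longrightarrow> poly q' x \<ge> lead_coeff q'"
      using poly_pinfty_gt_lc[of q'] lc q(2) by metis
    define t where "t = max 1 (max a b)"
    have "poly q t > 0"
      using order.strict_trans2[OF q(2) a[of t]] by (simp add: t_def)
    moreover have "poly q' t > 0"
      using order.strict_trans2[OF q(2)[folded lc] b[of t]] by (simp add: t_def)
    then have "poly q (- t) < 0"
      by (simp add: q'_def poly_pcompose)
    moreover have "- t < t" by (simp add: t_def)
    ultimately show ?thesis
      using poly_IVT_pos[of "- t" t q] by blast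
  qed
  show ?thesis
  proof (cases "lead_coeff p > 0")
    case True
    then show ?thesis using pos assms by blast
  next
    case False
    moreover have "p \<noteq> 0" using assms by auto
    ultimately have "lead_coeff (- p) > 0"
      by (simp add: order.not_eq_order_implies_strict)
    then show ?thesis using pos[of "- p"] assms by auto
  qed
qed

section \<open>Integer vectors and congruences modulo \<open>N\<close>\<close>

definition smul :: "int \<Rightarrow> (nat \<Rightarrow> int) \<Rightarrow> (nat \<Rightarrow> int)" where
  "smul c x = (\<lambda>i. c * x i)"

definition cgr :: "int \<Rightarrow> (nat \<Rightarrow> int) \<Rightarrow> (nat \<Rightarrow> int) \<Rightarrow> bool" where
  "cgr N x y \<longleftrightarrow> (\<forall>i. N dvd x i - y i)"

definition unitv :: "nat \<Rightarrow> nat \<Rightarrow> int" where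
  "unitv j = (\<lambda>i. if i = j then 1 else 0)"

lemma smul_apply: "smul c x i = c * x i"
  by (simp add: smul_def)

text \<open>As simplification rules these would also turn unapplied sums into abstractions.\<close>

declare plus_fun_apply [simp del] zero_fun_apply [simp del] minus_apply [simp del] uminus_apply [simp del]

lemmas pointwise = plus_fun_apply zero_fun_apply minus_apply uminus_apply smul_apply

lemma lattice_zero [simp]: "0 \<in> lattice k"
  and lattice_add [simp]: "x \<in> lattice k \<Longrightarrow> y \<in> lattice k \<Longrightarrow> x + y \<in> lattice k"
  and lattice_diff [simp]: "x \<in> lattice k \<Longrightarrow> y \<in> lattice k \<Longrightarrow> x - y \<in> lattice k"
  and lattice_uminus [simp]: "x \<in> lattice k \<Longrightarrow> - x \<in> lattice k"
  and lattice_smul [simp]: "x \<in> lattice k \<Longrightarrow> smul c x \<in> lattice k"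
  and lattice_unitv [simp]: "j < k \<Longrightarrow> unitv j \<in> lattice k"
  by (auto simp: lattice_def unitv_def pointwise)

lemma lattice_sum: "(\<And>i. i \<in> I \<Longrightarrow> x i \<in> lattice k) \<Longrightarrow> sum x I \<in> lattice k"
  by (induction I rule: infinite_finite_induct) auto

lemma sum_fun_apply: "sum f I z = (\<Sum>i\<in>I. f i z)"
  by (induction I rule: infinite_finite_induct) (auto simp: pointwise)

lemma lattice_decomp:
  assumes "x \<in> lattice k"
  shows "x = (\<Sum>j<k. smul (x j) (unitv j))"
proof
  fix i
  have "(\<Sum>j<k. x j * (if i = j then 1 else 0)) = (\<Sum>j<k. if i = j then x j else 0)"
    by (rule sum.cong) auto
  also have "\<dots> = x i"
    using assms by (auto simp: lattice_def)
  finally show "x i = (\<Sum>j<k. smul (x j) (unitv j)) i"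
    by (simp add: sum_fun_apply pointwise unitv_def pointwise)
qed

lemma cgr_refl [simp]: "cgr N x x"
  by (simp add: cgr_def pointwise)

lemma cgr_sym: "cgr N x y \<Longrightarrow> cgr N y x"
  by (simp add: cgr_def pointwise dvd_diff_commute)

lemma cgr_trans: "cgr N x y \<Longrightarrow> cgr N y z \<Longrightarrow> cgr N x z"
  unfolding cgr_def by (metis diff_add_cancel dvd_add add_diff_eq)

lemma cgr_add: "cgr N x y \<Longrightarrow> cgr N x' y' \<Longrightarrow> cgr N (x + x') (y + y')"
  by (simp add: cgr_def pointwise add_diff_add)

lemma cgr_smul: "cgr N x y \<Longrightarrow> cgr N (smul c x) (smul c y)"
  by (simp add: cgr_def pointwise dvd_mult flip: right_diff_distrib)

lemma cgr_sum: "(\<And>i. i \<in> I \<Longrightarrow> cgr N (x i) (y i)) \<Longrightarrow> cgr N (sum x I) (sum y I)"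
  by (induction I rule: infinite_finite_induct) (auto intro: cgr_add)

lemma cgr_imp_smul:
  assumes "cgr N x y" "x \<in> lattice k" "y \<in> lattice k"
  obtains z where "z \<in> lattice k" "x = y + smul N z"
proof
  let ?z = "\<lambda>i. (x i - y i) div N"
  show "?z \<in> lattice k" using assms by (auto simp: lattice_def)
  show "x = y + smul N ?z" using assms(1) by (auto simp: cgr_def pointwise)
qed

lemma cgr_add_smul: "cgr N (y + smul N z) y"
  by (simp add: cgr_def pointwise)

text \<open>Standard representatives of the classes of \<open>lattice k\<close> modulo
  \<open>N\<close>, used wherever finiteness of the quotient matters.\<close>

definition box :: "nat \<Rightarrow> nat \<Rightarrow> (nat \<Rightarrow> int) set" where
  "box k N = {y \<in> lattice k. \<forall>i. 0 \<le> y i \<and> y i < int N}"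

lemma finite_box: "finite (box k N)"
proof (rule finite_subset)
  show "box k N \<subseteq> {f. \<forall>x. (x \<in> {..<k} \<longrightarrow> f x \<in> {0..<int N}) \<and> (x \<notin> {..<k} \<longrightarrow> f x = 0)}"
    by (auto simp: box_def lattice_def)
  show "finite {f. \<forall>x. (x \<in> {..<k} \<longrightarrow> f x \<in> {0..<int N}) \<and> (x \<notin> {..<k} \<longrightarrow> f x = 0)}"
    by (rule finite_set_of_finite_funs) auto
qed

lemma mod_in_box: "x \<in> lattice k \<Longrightarrow> N > 0 \<Longrightarrow> (\<lambda>i. x i mod int N) \<in> box k N"
  by (auto simp: box_def lattice_def)

text \<open>\<open>A\<close> is a total function on all integer sequences, constrained only on
  \<open>lattice k\<close>; hence the membership conditions throughout.\<close>

locale lattice_endo =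
  fixes k :: nat and A :: "(nat \<Rightarrow> int) \<Rightarrow> (nat \<Rightarrow> int)"
  assumes closed [simp]: "x \<in> lattice k \<Longrightarrow> A x \<in> lattice k"
    and add: "x \<in> lattice k \<Longrightarrow> y \<in> lattice k \<Longrightarrow> A (x + y) = A x + A y"
begin

lemma zero [simp]: "A 0 = 0"
  using add[of 0 0] by simp

lemma uminus: "x \<in> lattice k \<Longrightarrow> A (- x) = - A x"
  using add[of x "- x"] by (simp add: minus_unique)

lemma smul:
  assumes "x \<in> lattice k"
  shows "A (smul c x) = smul c (A x)"
proof -
  have nat: "A (smul (int n) x) = smul (int n) (A x)" for n
  proof (induction n)
    case 0
    have "smul 0 y = 0" for y by (simp add: fun_eq_iff pointwise)
    then show ?case by simp
  next
    case (Suc n)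
    have "smul (int (Suc n)) y = smul (int n) y + y" for y
      by (simp add: fun_eq_iff pointwise algebra_simps)
    then show ?case using Suc assms by (simp add: add)
  qed
  have neg: "smul (- d) y = - smul d y" for d y
    by (simp add: fun_eq_iff pointwise)
  show ?thesis
  proof (cases c rule: int_cases2)
    case (nonneg n)
    then show ?thesis using nat by simp
  next
    case (nonpos n)
    then show ?thesis using nat assms by (simp add: neg uminus)
  qed
qed

lemma sum: "(\<And>i. i \<in> I \<Longrightarrow> x i \<in> lattice k) \<Longrightarrow> A (sum x I) = (\<Sum>i\<in>I. A (x i))"
  by (induction I rule: infinite_finite_induct) (auto simp: add lattice_sum)

lemma cgr:
  assumes "cgr N x y" "x \<in> lattice k" "y \<in> lattice k"
  shows "cgr N (A x) (A y)"
proof -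
  obtain z where "z \<in> lattice k" "x = y + smul N z"
    using cgr_imp_smul assms by blast
  then show ?thesis using assms by (simp add: add smul cgr_add_smul)
qed

lemma funpow: "lattice_endo k (A ^^ i)"
proof (induction i)
  case 0
  show ?case by unfold_locales auto
next
  case (Suc i)
  then interpret P: lattice_endo k "A ^^ i" .
  show ?case by unfold_locales (auto simp: P.add add)
qed

text \<open>Modulo a prime larger than \<open>M\<close> the map \<open>1 - A\<close> is surjective, hence injective.\<close>

lemma inj_of_torsion_cokernel:
  assumes "\<And>v. v \<in> lattice k \<Longrightarrow> \<exists>D\<in>{1..M}. \<exists>y\<in>lattice k. smul (int D) v = y - A y"
    and x: "x \<in> lattice k" "A x = x"
  shows "x = 0"
proof (rule ccontr)
  assume "x \<noteq> 0"
  then obtain i where i: "x i \<noteq> 0" by (auto simp: fun_eq_iff pointwise)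
  \<comment> \<open>A prime beyond \<open>M\<close> makes every \<open>D\<close> in
    \<open>{1..M}\<close> a unit modulo \<open>q\<close>; being also larger than the absolute value
    of \<open>x i\<close>, it cannot divide that nonzero entry.\<close>
  obtain q :: nat where q: "Factorial_Ring.prime q" "q > M + nat \<bar>x i\<bar>"
    using bigger_prime by blast
  define B where "B = box k q"
  have finB: "finite B" by (simp add: B_def finite_box)
  define red where "red y = (\<lambda>i. y i mod int q)" for y :: "nat \<Rightarrow> int"
  have redB: "red y \<in> B" if "y \<in> lattice k" for y
    using that q mod_in_box[of y k q] by (simp add: red_def B_def)
  have red_eq: "red y = red z \<longleftrightarrow> cgr (int q) y z" for y z
    by (simp add: red_def cgr_def pointwise fun_eq_iff mod_eq_dvd_iff)
  have red_cgr: "cgr (int q) (red y) y" for y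
    by (simp add: cgr_def pointwise red_def mod_eq_dvd_iff[symmetric])
  have red_id: "red y = y" if "y \<in> B" for y
    using that by (auto simp: red_def B_def box_def)
  have BL: "y \<in> lattice k" if "y \<in> B" for y using that by (simp add: B_def box_def)
  \<comment> \<open>The map induced by \<open>1 - A\<close> on representatives modulo
    \<open>q\<close>.\<close>
  define g where "g y = red (y - A y)" for y
  have g_cgr: "g y = g z" if "cgr (int q) y z" "y \<in> lattice k" "z \<in> lattice k" for y z
  proof -
    have "cgr (int q) (smul (-1) (A y)) (smul (-1) (A z))"
      using cgr that cgr_smul by blast
    then have "cgr (int q) (y + smul (-1) (A y)) (z + smul (-1) (A z))"
      using that cgr_add by blast
    moreover have "smul (-1) v = - v" for v by (simp add: fun_eq_iff pointwise)
    ultimately show ?thesis by (simp add: g_def red_eq)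
  qed
  \<comment> \<open>If \<open>D v = y - A y\<close> and \<open>D'\<close> inverts \<open>D\<close>
    modulo \<open>q\<close>, then \<open>D' y\<close> is a preimage of \<open>v\<close>.\<close>
  have "g ` B = B"
  proof
    show "g ` B \<subseteq> B" using redB BL by (auto simp: g_def)
    show "B \<subseteq> g ` B"
    proof
      fix v assume v: "v \<in> B"
      obtain D y where D: "D \<in> {1..M}" "y \<in> lattice k" "smul (int D) v = y - A y"
        using assms(1)[OF BL[OF v]] by blast
      have "\<not> q dvd D" using D q by (auto dest: dvd_imp_le)
      then have "coprime (int D) (int q)"
        using q prime_imp_coprime[of q D] by (simp add: coprime_commute)
      then obtain D' where D': "[int D * D' = 1] (mod int q)"
        using cong_solve_coprime_int by blast
      have "g (red (smul D' y)) = g (smul D' y)"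
        using D redB BL by (intro g_cgr red_cgr) auto
      also have "\<dots> = red (smul D' (y - A y))"
        using D by (auto simp: g_def smul fun_eq_iff pointwise red_def algebra_simps)
      also have "\<dots> = red (smul (int D * D') v)"
        unfolding D(3)[symmetric] by (auto simp: fun_eq_iff pointwise red_def algebra_simps)
      also have "\<dots> = red v"
      proof -
        have "int q dvd int D * D' - 1" using D' by (simp add: cong_iff_dvd_diff)
        then have "int q dvd (int D * D' - 1) * v i" for i by (rule dvd_mult2)
        then show ?thesis by (simp add: red_eq cgr_def pointwise left_diff_distrib)
      qed
      finally have "v = g (red (smul D' y))" using red_id v by simp
      then show "v \<in> g ` B" using redB D by auto
    qed
  qed
  then have inj: "inj_on g B" using finB by (intro eq_card_imp_inj_on) auto
  have "g (red x) = g x" using x redB BL by (intro g_cgr red_cgr) auto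
  also have "\<dots> = red 0" using x by (simp add: g_def)
  also have "\<dots> = g (red 0)" 
  proof -
    have "red 0 = 0" by (simp add: red_def fun_eq_iff pointwise)
    then show ?thesis by (simp add: g_def)
  qed
  finally have "red x = red 0" using inj redB x by (auto dest: inj_onD)
  then have "int q dvd x i" by (auto simp: red_eq cgr_def pointwise)
  then have "int q \<le> \<bar>x i\<bar>" using i dvd_imp_le_int[of "x i" "int q"] by simp
  then show False using q by linarith
qed

text \<open>In odd dimension there is a real eigenvalue \<open>x\<close>. The vanishing of
  \<open>1 + x + ... + x ^ (h - 1)\<close> gives \<open>x ^ h = 1\<close>, so \<open>x = 1\<close>
  because \<open>h\<close> is odd, and then the sum is \<open>h\<close>, which is not 0.\<close>

lemma power_sum_nonzero:
  assumes "odd k" "odd h"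
    and sum0: "\<And>y. y \<in> lattice k \<Longrightarrow> (\<Sum>i<h. (A ^^ i) y) = 0"
  shows False
proof -
  \<comment> \<open>The columns are the images of the unit vectors, so the powers of
    \<open>M\<close> represent the iterates of \<open>A\<close>.\<close>
  define M :: "real mat" where "M = mat k k (\<lambda>(l, j). of_int (A (unitv j) l))"
  have M: "M \<in> carrier_mat k k" by (simp add: M_def)
  have Mpow: "(M ^\<^sub>m i) $$ (l, j) = of_int ((A ^^ i) (unitv j) l)" if "l < k" "j < k" for i l j
    using that
  proof (induction i arbitrary: l j)
    case 0
    then show ?case using M by (auto simp: unitv_def pointwise)
  next
    case (Suc i)
    interpret P: lattice_endo k "A ^^ i" by (rule funpow)
    have Mi: "M ^\<^sub>m i \<in> carrier_mat k k" using M by (rule pow_carrier_mat)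
    have AL: "A (unitv j) \<in> lattice k" using Suc by simp
    have "(M ^\<^sub>m Suc i) $$ (l, j) = (\<Sum>t<k. (M ^\<^sub>m i) $$ (l, t) * M $$ (t, j))"
      using Suc.prems M Mi by (simp add: scalar_prod_def atLeast0LessThan)
    also have "\<dots> = (\<Sum>t<k. of_int ((A ^^ i) (unitv t) l * A (unitv j) t))"
    proof (rule sum.cong)
      fix t assume "t \<in> {..<k}"
      then have "M $$ (t, j) = of_int (A (unitv j) t)" "(M ^\<^sub>m i) $$ (l, t) = of_int ((A ^^ i) (unitv t) l)"
        using Suc.prems Suc.IH by (auto simp: M_def)
      then show "(M ^\<^sub>m i) $$ (l, t) * M $$ (t, j) = of_int ((A ^^ i) (unitv t) l * A (unitv j) t)"
        by simp
    qed simp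
    also have "\<dots> = of_int ((\<Sum>t<k. smul (A (unitv j) t) ((A ^^ i) (unitv t))) l)"
      by (simp add: sum_fun_apply pointwise mult.commute)
    also have "(\<Sum>t<k. smul (A (unitv j) t) ((A ^^ i) (unitv t))) = (A ^^ i) (\<Sum>t<k. smul (A (unitv j) t) (unitv t))"
      by (subst P.sum) (auto simp: P.smul)
    also have "(\<Sum>t<k. smul (A (unitv j) t) (unitv t)) = A (unitv j)"
      using lattice_decomp[OF AL] by simp
    finally show ?case by (simp add: funpow_swap1)
  qed
  have "odd (degree (char_poly M))" using degree_monic_char_poly[OF M] assms by simp
  then obtain x where "poly (char_poly M) x = 0" using odd_degree_real_root by blast
  then obtain v where v: "eigenvector M v x"
    using eigenvalue_root_char_poly[OF M] by (auto simp: eigenvalue_def)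
  then have vc: "v \<in> carrier_vec k" "v \<noteq> 0\<^sub>v k" using M by (auto simp: eigenvector_def)
  then obtain l where l: "l < k" "v $ l \<noteq> 0" by (metis carrier_vecD eq_vecI index_zero_vec)
  \<comment> \<open>On an eigenvector the vanishing sum of iterates becomes the scalar sum of powers
    of the eigenvalue.\<close>
  have "(\<Sum>i<h. x ^ i) * v $ l = (\<Sum>i<h. ((M ^\<^sub>m i) *\<^sub>v v) $ l)"
    using eigenvector_pow[OF M v] l vc by (simp add: sum_distrib_right)
  also have "\<dots> = (\<Sum>i<h. \<Sum>j<k. of_int ((A ^^ i) (unitv j) l) * v $ j)"
  proof (rule sum.cong)
    fix i
    have Mi: "M ^\<^sub>m i \<in> carrier_mat k k" using M by (rule pow_carrier_mat)
    show "((M ^\<^sub>m i) *\<^sub>v v) $ l = (\<Sum>j<k. of_int ((A ^^ i) (unitv j) l) * v $ j)"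
      using l carrier_vecD[OF vc(1)] carrier_matD[OF Mi]
      by (simp add: scalar_prod_def atLeast0LessThan Mpow)
  qed auto
  also have "\<dots> = (\<Sum>j<k. of_int ((\<Sum>i<h. (A ^^ i) (unitv j)) l) * v $ j)"
    by (subst sum.swap) (simp add: sum_fun_apply pointwise sum_distrib_right)
  also have "\<dots> = 0" using sum0 by (simp add: pointwise)
  finally have s0: "(\<Sum>i<h. x ^ i) = 0" using l by simp
  then have "x ^ h = 1" using power_diff_1_eq[of x h] by simp
  then have "x = 1"
    using \<open>odd h\<close> by (metis odd_pos odd_real_root_power_cancel real_root_one)
  then show False using s0 \<open>odd h\<close> by auto
qed

end

section \<open>Automorphisms of the lattice, their orbits modulo powers of 2, and invariant
  weights\<close>

locale lattice_auto = lattice_endo +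
  fixes B :: "(nat \<Rightarrow> int) \<Rightarrow> (nat \<Rightarrow> int)"
  assumes inv_closed [simp]: "x \<in> lattice k \<Longrightarrow> B x \<in> lattice k"
    and inv_left [simp]: "x \<in> lattice k \<Longrightarrow> B (A x) = x"
    and inv_right [simp]: "x \<in> lattice k \<Longrightarrow> A (B x) = x"
begin

sublocale inv: lattice_endo k B
proof
  fix x y assume "x \<in> lattice k" "y \<in> lattice k"
  then have "B (A (B x + B y)) = B (x + y)" by (simp add: add)
  then show "B (x + y) = B x + B y"
    using \<open>x \<in> _\<close> \<open>y \<in> _\<close> by simp
qed simp

lemma funpow_cgr_cancel:
  assumes "cgr N ((A ^^ i) x) ((A ^^ i) y)" "x \<in> lattice k" "y \<in> lattice k"
  shows "cgr N x y"
  using assms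
proof (induction i)
  case (Suc i)
  interpret P: lattice_endo k "A ^^ i" by (rule funpow)
  have "cgr N (B ((A ^^ Suc i) x)) (B ((A ^^ Suc i) y))"
    using Suc.prems lattice_endo.closed[OF funpow] by (intro inv.cgr) blast+
  then show ?case using Suc lattice_endo.closed[OF funpow] by simp
qed simp

text \<open>All return times of \<open>y\<close> modulo \<open>2 ^ e\<close> being even, signs can
  alternate along its orbit. If no such \<open>y\<close> exists, every vector has an odd return time
  for every \<open>e\<close>. This forces \<open>A ^^ h\<close> to be the identity on the lattice
  for some odd \<open>h\<close>; then \<open>1 + A + ... + A ^^ (h - 1)\<close> maps into the fixed
  vectors, so it vanishes, contrary to \<open>power_sum_nonzero\<close>.\<close>

lemma ex_even_orbit:
  assumes "odd k" and fix0: "\<And>x. x \<in> lattice k \<Longrightarrow> A x = x \<Longrightarrow> x = 0"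
  shows "\<exists>e. \<exists>y\<in>lattice k. \<forall>i. cgr (2 ^ e) ((A ^^ i) y) y \<longrightarrow> even i"
proof (rule ccontr)
  assume "\<not> ?thesis"
  then have H: "\<exists>i. odd i \<and> cgr (2 ^ e) ((A ^^ i) y) y" if "y \<in> lattice k" for e y
    using that by blast
  have pow_closed: "(A ^^ i) y \<in> lattice k" if "y \<in> lattice k" for i y
    using lattice_endo.closed[OF funpow that] .
  have cgr_pow: "cgr N ((A ^^ (i * m)) y) y" if "cgr N ((A ^^ i) y) y" "y \<in> lattice k" for N i m y
  proof (induction m)
    case (Suc m)
    have "cgr N ((A ^^ i) ((A ^^ (i * m)) y)) ((A ^^ i) y)"
      using Suc that pow_closed by (intro lattice_endo.cgr[OF funpow]) auto
    then have "cgr N ((A ^^ (i * Suc m)) y) ((A ^^ i) y)"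
      by (simp add: funpow_add)
    then show ?case using that cgr_trans by blast
  qed simp
  \<comment> \<open>The product of odd return times of the unit vectors serves all vectors, by
    linearity.\<close>
  have unif: "\<exists>i. odd i \<and> (\<forall>y\<in>lattice k. cgr (2 ^ e) ((A ^^ i) y) y)" for e
  proof -
    have "\<forall>j<k. \<exists>i. odd i \<and> cgr (2 ^ e) ((A ^^ i) (unitv j)) (unitv j)"
      using H by simp
    then obtain f where f: "\<And>j. j < k \<Longrightarrow> odd (f j) \<and> cgr (2 ^ e) ((A ^^ f j) (unitv j)) (unitv j)"
      by metis
    define i where "i = (\<Prod>j<k. f j)"
    interpret P: lattice_endo k "A ^^ i" by (rule funpow)
    have "odd i" using f by (simp add: i_def even_prod_iff)
    have ui: "cgr (2 ^ e) ((A ^^ i) (unitv j)) (unitv j)" if "j < k" for j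
    proof -
      have "f j dvd i" using that by (simp add: i_def dvd_prodI)
      then show ?thesis using cgr_pow f that by (auto elim!: dvdE)
    qed
    have "cgr (2 ^ e) ((A ^^ i) y) y" if "y \<in> lattice k" for y
    proof -
      have "(A ^^ i) y = (A ^^ i) (\<Sum>j<k. smul (y j) (unitv j))"
        using lattice_decomp[OF that] by simp
      also have "\<dots> = (\<Sum>j<k. smul (y j) ((A ^^ i) (unitv j)))"
        by (subst P.sum) (auto simp: P.smul)
      finally have "(A ^^ i) y = (\<Sum>j<k. smul (y j) ((A ^^ i) (unitv j)))" .
      moreover have "cgr (2 ^ e) (\<Sum>j<k. smul (y j) ((A ^^ i) (unitv j))) (\<Sum>j<k. smul (y j) (unitv j))"
        using ui by (intro cgr_sum cgr_smul) auto
      ultimately show ?thesis using lattice_decomp[OF that] by simp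
    qed
    then show ?thesis using \<open>odd i\<close> by blast
  qed
  \<comment> \<open>The modulus 2 determines \<open>h\<close>; \<open>lift\<close> raises the
    modulus while keeping this \<open>h\<close>.\<close>
  obtain h where h: "odd h" "\<And>y. y \<in> lattice k \<Longrightarrow> cgr (2 ^ 1) ((A ^^ h) y) y"
    using unif[of 1] by blast
  interpret P: lattice_endo k "A ^^ h" by (rule funpow)
  define d where "d y = (A ^^ h) y - y" for y
  have dL: "d y \<in> lattice k" if "y \<in> lattice k" for y using that by (simp add: d_def)
  \<comment> \<open>If \<open>2 ^ Suc e\<close> divides all values of \<open>d\<close>, then
    \<open>d (d y)\<close> vanishes modulo \<open>2 ^ Suc (Suc e)\<close>, so
    \<open>A ^^ (h * i)\<close> sends \<open>y\<close> to \<open>y + i d y\<close> there. An odd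
    return time \<open>i\<close> for that modulus gives \<open>i d y = 0\<close>, and the odd factor
    \<open>i\<close> cancels.\<close>
  have lift: "cgr (2 ^ Suc e) (d y) 0" if y: "y \<in> lattice k" for e y
    using y
  proof (induction e arbitrary: y)
    case 0
    then show ?case using h(2)[of y] by (simp add: cgr_def d_def pointwise)
  next
    case (Suc e)
    obtain c where c: "c \<in> lattice k" "d y = smul (2 ^ Suc e) c"
      using cgr_imp_smul[OF Suc.IH] Suc.prems dL by (metis add_0 lattice_zero)
    have "d (d y) = smul (2 ^ Suc e) (d c)"
      using c by (simp add: d_def P.smul) (simp add: fun_eq_iff pointwise right_diff_distrib)
    moreover have "2 ^ Suc (Suc e) dvd 2 ^ Suc e * d c l" for l
    proof -
      have "2 ^ Suc e dvd d c l" using Suc.IH[OF c(1)] by (simp add: cgr_def pointwise)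
      then have "2 dvd d c l" using dvd_mult_left[of 2 "2 ^ e" "d c l"] by simp
      then obtain t where "d c l = 2 * t" by blast
      then have "2 ^ Suc e * d c l = 2 ^ Suc (Suc e) * t" by simp
      then show ?thesis by (rule dvdI)
    qed
    ultimately have "cgr (2 ^ Suc (Suc e)) (d (d y)) 0"
      by (simp only: cgr_def pointwise) simp
    then have dd: "cgr (2 ^ Suc (Suc e)) ((A ^^ h) (d y)) (d y)"
      by (simp add: d_def cgr_def pointwise)
    have it: "cgr (2 ^ Suc (Suc e)) ((A ^^ (h * i)) y) (y + smul (int i) (d y))" for i
    proof (induction i)
      case 0
      then show ?case by (simp add: cgr_def pointwise)
    next
      case (Suc i)
      have "cgr (2 ^ Suc (Suc e)) ((A ^^ h) ((A ^^ (h * i)) y)) ((A ^^ h) (y + smul (int i) (d y)))"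
        using Suc \<open>y \<in> _\<close> pow_closed dL by (intro P.cgr) auto
      also have "(A ^^ h) (y + smul (int i) (d y)) = (A ^^ h) y + smul (int i) ((A ^^ h) (d y))"
        using \<open>y \<in> _\<close> dL by (simp add: P.add P.smul)
      finally have 1: "cgr (2 ^ Suc (Suc e)) ((A ^^ (h * Suc i)) y) ((A ^^ h) y + smul (int i) ((A ^^ h) (d y)))"
        by (simp add: funpow_add)
      have "cgr (2 ^ Suc (Suc e)) ((A ^^ h) y + smul (int i) ((A ^^ h) (d y))) ((A ^^ h) y + smul (int i) (d y))"
        by (intro cgr_add cgr_smul dd cgr_refl)
      also have "(A ^^ h) y + smul (int i) (d y) = y + smul (int (Suc i)) (d y)"
        by (simp add: d_def fun_eq_iff pointwise algebra_simps)
      finally show ?case using 1 cgr_trans by blast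
    qed
    obtain i where i: "odd i" "cgr (2 ^ Suc (Suc e)) ((A ^^ i) y) y"
      using unif Suc.prems by blast
    have "cgr (2 ^ Suc (Suc e)) ((A ^^ (h * i)) y) y"
      using cgr_pow[OF i(2) Suc.prems, of h] by (simp add: mult.commute)
    then have "cgr (2 ^ Suc (Suc e)) (y + smul (int i) (d y)) y"
      using it cgr_sym cgr_trans by blast
    then have "2 ^ Suc (Suc e) dvd int i * d y l" for l
      by (simp add: cgr_def pointwise)
    moreover have "coprime (2 ^ Suc (Suc e)) (int i)"
      using i(1) by (simp only: coprime_power_left_iff coprime_left_2_iff_odd even_of_nat) simp
    ultimately show ?case
      by (simp add: cgr_def pointwise coprime_dvd_mult_right_iff)
  qed
  have Ah: "(A ^^ h) y = y" if y: "y \<in> lattice k" for y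
  proof
    fix l
    \<comment> \<open>The power \<open>2 ^ Suc e\<close> divides this entry and exceeds it in
      absolute value, so the entry is 0.\<close>
    define e where "e = nat \<bar>d y l\<bar>"
    have "2 ^ Suc e dvd d y l" using lift[OF y, of e] by (simp add: cgr_def pointwise)
    moreover have "\<bar>d y l\<bar> < 2 ^ Suc e"
    proof -
      have "e < 2 ^ Suc e" using less_exp[of e] by (simp del: less_exp)
      then have "int e < int (2 ^ Suc e)" by (simp only: of_nat_less_iff)
      then show ?thesis by (simp add: e_def)
    qed
    ultimately have "d y l = 0" by (metis abs_of_pos dvd_imp_le_int linorder_not_le zero_less_numeral zero_less_power)
    then show "(A ^^ h) y l = y l" by (simp add: d_def pointwise)
  qed
  \<comment> \<open>Applying \<open>A\<close> changes the sum by \<open>(A ^^ h) y - y\<close>,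
    which is 0, so the sum is a fixed vector.\<close>
  have "(\<Sum>i<h. (A ^^ i) y) = 0" if y: "y \<in> lattice k" for y
  proof (rule fix0)
    show "(\<Sum>i<h. (A ^^ i) y) \<in> lattice k" using y pow_closed by (intro lattice_sum) auto
    have "A (\<Sum>i<h. (A ^^ i) y) = (\<Sum>i<h. (A ^^ Suc i) y)"
      using y pow_closed by (subst sum) auto
    also have "\<dots> = (\<Sum>i<h. (A ^^ i) y) + ((A ^^ h) y - y)"
      by (induction h) (simp_all add: algebra_simps)
    finally show "A (\<Sum>i<h. (A ^^ i) y) = (\<Sum>i<h. (A ^^ i) y)" using Ah[OF y] by simp
  qed
  then show False using power_sum_nonzero[OF \<open>odd k\<close> \<open>odd h\<close>] by blast
qed

end

context lattice_auto
begin

lemma cgr_iff: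
  assumes "x \<in> lattice k" "y \<in> lattice k"
  shows "cgr N (A x) (A y) \<longleftrightarrow> cgr N x y"
  using funpow_cgr_cancel[of N 1 x y] cgr[of N x y] assms by auto

text \<open>The case \<open>c = 2\<close>, \<open>p = 3\<close> stands for the sign \<open>c = -1\<close> modulo 3.\<close>

lemma ex_weight:
  assumes "k \<ge> 1" and fix0: "\<And>x. x \<in> lattice k \<Longrightarrow> A x = x \<Longrightarrow> x = 0"
    and "c = 1 \<and> p \<ge> 2 \<or> c = 2 \<and> p = 3 \<and> odd k"
  obtains M :: nat and w :: "(nat \<Rightarrow> int) \<Rightarrow> nat" and y where "M > 0" "y \<in> lattice k"
    "\<And>x y. x \<in> lattice k \<Longrightarrow> y \<in> lattice k \<Longrightarrow> cgr (int M) x y \<Longrightarrow> w x = w y"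
    "\<And>x. x \<in> lattice k \<Longrightarrow> [c * w (A x) = w x] (mod p)"
    "w 0 = 0" "0 < w y" "w y < p"
  using assms(3)
proof (elim disjE conjE)
  assume c: "c = 1" "p \<ge> 2"
  \<comment> \<open>\<open>A\<close> permutes the classes modulo 2 and fixes the zero class, so the
    indicator of the other classes is invariant.\<close>
  define w :: "(nat \<Rightarrow> int) \<Rightarrow> nat" where "w x = (if cgr 2 x 0 then 0 else 1)" for x
  show thesis
  proof (rule that[of 2 "unitv 0" w])
    show "unitv 0 \<in> lattice k" using assms(1) by simp
    show "w x = w y" if "cgr (int 2) x y" for x y
    proof -
      have "cgr 2 x 0 \<longleftrightarrow> cgr 2 y 0"
        using that cgr_sym[of 2 x y] cgr_trans[of 2 x y 0] cgr_trans[of 2 y x 0] by auto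
      then show ?thesis by (simp add: w_def)
    qed
    show "[c * w (A x) = w x] (mod p)" if "x \<in> lattice k" for x
      using cgr_iff[OF that lattice_zero, of 2] by (simp add: w_def c)
    have "w (unitv 0) = 1" by (auto simp: w_def cgr_def unitv_def pointwise)
    then show "0 < w (unitv 0)" "w (unitv 0) < p" using c by auto
  qed (auto simp: w_def)
next
  assume c: "c = 2" "p = 3" "odd k"
  obtain e y where y: "y \<in> lattice k" and ev: "\<And>i. cgr (2 ^ e) ((A ^^ i) y) y \<Longrightarrow> even i"
    using ex_even_orbit[OF c(3) fix0] by blast
  \<comment> \<open>The class of \<open>x\<close> lies on the orbit of \<open>y\<close>, with offset
    \<open>j - i\<close>. By \<open>Rpar\<close> the parity of the offset depends on
    \<open>x\<close> only.\<close>
  define R where "R x i j \<longleftrightarrow> cgr (2 ^ e) ((A ^^ i) x) ((A ^^ j) y)" for x i j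
  have pow_closed: "(A ^^ i) x \<in> lattice k" if "x \<in> lattice k" for i x
    using lattice_endo.closed[OF funpow that] .
  have parity: "even (i + j)" if "cgr (2 ^ e) ((A ^^ i) y) ((A ^^ j) y)" for i j
  proof -
    have *: "even (i + j)" if "cgr (2 ^ e) ((A ^^ i) y) ((A ^^ j) y)" "i \<ge> j" for i j
    proof -
      have "i = j + (i - j)" using that by simp
      then have "cgr (2 ^ e) ((A ^^ j) ((A ^^ (i - j)) y)) ((A ^^ j) y)"
        using that by (metis funpow_add o_apply)
      then have "even (i - j)" using ev funpow_cgr_cancel pow_closed y by blast
      then show ?thesis using that by simp
    qed
    show ?thesis using *[of i j] *[of j i] that cgr_sym by (metis add.commute nat_le_linear)
  qed
  have Rshift: "R x (i + m) (j + m)" if "R x i j" "x \<in> lattice k" for x i j m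
  proof -
    have "cgr (2 ^ e) ((A ^^ m) ((A ^^ i) x)) ((A ^^ m) ((A ^^ j) y))"
      using that y pow_closed by (intro lattice_endo.cgr[OF funpow]) (auto simp: R_def)
    then show ?thesis by (simp add: R_def funpow_add add.commute[of _ m])
  qed
  have Rpar: "even (i + j) \<longleftrightarrow> even (i' + j')" if "R x i j" "R x i' j'" "x \<in> lattice k" for x i j i' j'
  proof -
    have "cgr (2 ^ e) ((A ^^ (j + i')) y) ((A ^^ (j' + i)) y)"
      using Rshift[OF that(1,3), of i'] Rshift[OF that(2,3), of i]
        cgr_trans[OF cgr_sym] unfolding R_def add.commute[of i' i] by blast
    then have "even (j + i' + (j' + i))" by (rule parity)
    then show ?thesis by auto
  qed
  \<comment> \<open>The values 1 and 2 are the two signs modulo 3. They alternate along the orbit,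
    as applying \<open>A\<close> changes the offset by one; off the orbit the weight is 0.\<close>
  define w :: "(nat \<Rightarrow> int) \<Rightarrow> nat" where
    "w x = (if \<exists>i j. R x i j \<and> even (i + j) then 1 else if \<exists>i j. R x i j then 2 else 0)" for x
  have w1: "w x = (if even (i + j) then 1 else 2)" if "R x i j" "x \<in> lattice k" for x i j
  proof (cases "even (i + j)")
    case True
    then show ?thesis using that(1) unfolding w_def by auto
  next
    case False
    then have "\<not> (\<exists>i j. R x i j \<and> even (i + j))"
      using Rpar[OF that(1) _ that(2)] by blast
    then show ?thesis using that(1) False unfolding w_def by auto
  qed
  have w0: "w x = 0" if "\<not> (\<exists>i j. R x i j)" for x
    using that by (simp add: w_def)
  have Ryy: "R y 0 0" by (simp add: R_def)
  show thesis
  proof (rule that[of "2 ^ e" y w])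
    show "w x = w z" if "cgr (int (2 ^ e)) x z" "x \<in> lattice k" "z \<in> lattice k" for x z
    proof -
      have "cgr (2 ^ e) ((A ^^ i) x) ((A ^^ i) z)" for i
        using that by (intro lattice_endo.cgr[OF funpow]) auto
      then have "R x = R z"
        unfolding R_def fun_eq_iff using cgr_sym cgr_trans by blast
      then show ?thesis by (simp add: w_def)
    qed
    show "[c * w (A x) = w x] (mod p)" if x: "x \<in> lattice k" for x
    proof (cases "\<exists>i j. R x i j")
      case True
      then obtain i j where R: "R x i j" by blast
      from Rshift[OF this x, of 1] have "R (A x) i (Suc j)"
        by (simp add: R_def funpow_swap1)
      from w1[OF this] w1[OF R x] x show ?thesis by (auto simp: c cong_def)
    next
      case False
      have "\<not> (\<exists>i j. R (A x) i j)"
      proof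
        assume "\<exists>i j. R (A x) i j"
        then obtain i j where "R (A x) i j" by blast
        then have "R x (Suc i) j" by (simp add: R_def funpow_swap1)
        then show False using False by blast
      qed
      then show ?thesis using False by (simp add: w0)
    qed
    \<comment> \<open>Were 0 on the orbit, \<open>y\<close> would be 0 modulo \<open>2 ^ e\<close>
      and would have the odd return time 1.\<close>
    have "\<not> (\<exists>i j. R 0 i j)"
    proof
      assume "\<exists>i j. R 0 i j"
      then obtain i j where "cgr (2 ^ e) ((A ^^ i) 0) ((A ^^ j) y)" by (auto simp: R_def)
      moreover have "(A ^^ m) 0 = 0" for m by (induction m) auto
      ultimately have "cgr (2 ^ e) ((A ^^ j) 0) ((A ^^ j) y)" by simp
      then have "cgr (2 ^ e) 0 y" using funpow_cgr_cancel[OF _ lattice_zero y] by blast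
      moreover from this have "cgr (2 ^ e) (A 0) (A y)" using y by (intro cgr) auto
      ultimately have "cgr (2 ^ e) ((A ^^ 1) y) y" by (simp) (metis cgr_sym cgr_trans)
      then show False using ev[of 1] by simp
    qed
    then show "w 0 = 0" by (rule w0)
    show "0 < w y" "w y < p" using w1[OF Ryy y] c by auto
  qed (use y in auto)
qed

text \<open>
  The \<open>j\<close>-th weight is \<open>x \<mapsto> w (x / M\<^bsup>j\<^esup>)\<close>, extended by 0 to the vectors not divisible by \<open>M\<^bsup>j\<^esup>\<close>.
\<close>

lemma ex_weights:
  assumes "k \<ge> 1" and fix0: "\<And>x. x \<in> lattice k \<Longrightarrow> A x = x \<Longrightarrow> x = 0"
    and "c = 1 \<and> p \<ge> 2 \<or> c = 2 \<and> p = 3 \<and> odd k"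
  obtains M :: nat and w :: "nat \<Rightarrow> (nat \<Rightarrow> int) \<Rightarrow> nat" and t where "M > 0" "\<And>j. t j \<in> lattice k"
    "\<And>x y j m. x \<in> lattice k \<Longrightarrow> y \<in> lattice k \<Longrightarrow> j < m \<Longrightarrow> cgr (int M ^ m) x y \<Longrightarrow> w j x = w j y"
    "\<And>x j. x \<in> lattice k \<Longrightarrow> [c * w j (A x) = w j x] (mod p)"
    "\<And>j. 0 < w j (t j)" "\<And>j. w j (t j) < p" "\<And>i j. i < j \<Longrightarrow> w i (t j) = 0"
proof (rule ex_weight[OF assms])
  fix M :: nat and v :: "(nat \<Rightarrow> int) \<Rightarrow> nat" and y
  assume M: "M > 0" and y: "y \<in> lattice k"
    and per: "\<And>x y. x \<in> lattice k \<Longrightarrow> y \<in> lattice k \<Longrightarrow> cgr (int M) x y \<Longrightarrow> v x = v y"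
    and eqv: "\<And>x. x \<in> lattice k \<Longrightarrow> [c * v (A x) = v x] (mod p)"
    and v0: "v 0 = 0" and vy: "0 < v y" "v y < p"
  define w where "w j x = (if cgr (int M ^ j) x 0 then v (\<lambda>i. x i div int M ^ j) else 0)" for j x
  have w_smul: "w j (smul (int M ^ j) z) = v z" for j z
  proof -
    have "(\<lambda>i. smul (int M ^ j) z i div int M ^ j) = z" using M by (simp add: pointwise)
    then show ?thesis by (simp add: w_def cgr_def pointwise)
  qed
  have ex: "\<exists>z\<in>lattice k. x = smul (int M ^ j) z" if "cgr (int M ^ j) x 0" "x \<in> lattice k" for x j
    using cgr_imp_smul[OF that lattice_zero] by (metis add_0)
  show thesis
  proof (rule that[of M "\<lambda>j. smul (int M ^ j) y" w])
    fix x z j m assume x: "x \<in> lattice k" and z: "z \<in> lattice k" and "j < m" and xz: "cgr (int M ^ m) x z"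
    obtain d where m: "m = Suc d + j" using less_imp_Suc_add[OF \<open>j < m\<close>] by auto
    have xzj: "cgr (int M ^ j) x z" using xz \<open>j < m\<close> unfolding cgr_def
      by (meson dvd_trans le_imp_power_dvd less_imp_le)
    show "w j x = w j z"
    proof (cases "cgr (int M ^ j) x 0")
      case True
      then have "cgr (int M ^ j) z 0" using xzj cgr_sym cgr_trans by blast
      then obtain x' z' where x': "x' \<in> lattice k" "x = smul (int M ^ j) x'"
        and z': "z' \<in> lattice k" "z = smul (int M ^ j) z'"
        using ex True x z by metis
      \<comment> \<open>As \<open>j < m\<close>, at least one factor \<open>M\<close> of the modulus
        survives division by \<open>M ^ j\<close>.\<close>
      have "int M ^ j * int M dvd int M ^ j * (x' i - z' i)" for i
      proof -
        have "int M ^ j * int M dvd int M ^ m" by (simp add: m power_add)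
        moreover have "int M ^ m dvd int M ^ j * (x' i - z' i)"
          using xz unfolding x' z' cgr_def pointwise right_diff_distrib by blast
        ultimately show ?thesis by (rule dvd_trans)
      qed
      then have "cgr (int M) x' z'" using M by (simp add: cgr_def)
      then show ?thesis using per[OF x'(1) z'(1)] by (simp only: x'(2) z'(2) w_smul)
    next
      case False
      then have "\<not> cgr (int M ^ j) z 0" using xzj cgr_trans by blast
      then show ?thesis using False by (simp add: w_def)
    qed
  next
    fix x j assume x: "x \<in> lattice k"
    show "[c * w j (A x) = w j x] (mod p)"
    proof (cases "cgr (int M ^ j) x 0")
      case True
      then obtain x' where x': "x' \<in> lattice k" "x = smul (int M ^ j) x'" using ex x by blast
      then show ?thesis using eqv by (simp add: w_smul smul)
    next
      case False
      then have "\<not> cgr (int M ^ j) (A x) 0" using cgr_iff[OF x lattice_zero] by simp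
      then show ?thesis using False by (simp add: w_def)
    qed
  next
    fix i j :: nat assume "i < j"
    then obtain d where j: "j = i + Suc d" using less_imp_Suc_add[OF \<open>i < j\<close>] by auto
    \<comment> \<open>Division of the test vector by \<open>M ^ i\<close> leaves a multiple of
      \<open>M\<close>, where \<open>v\<close> takes the value \<open>v 0\<close>. The weights are
      thus triangular against the test vectors.\<close>
    have "smul (int M ^ j) y = smul (int M ^ i) (smul (int M ^ Suc d) y)"
      by (simp add: j fun_eq_iff pointwise power_add)
    then have "w i (smul (int M ^ j) y) = v (smul (int M ^ Suc d) y)" by (simp only: w_smul)
    also have "\<dots> = v 0" using y by (intro per) (auto simp: cgr_def pointwise)
    finally show "w i (smul (int M ^ j) y) = 0" using v0 by simp
  qed (use M y vy in \<open>auto simp: w_smul\<close>)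
qed

end

section \<open>Units of group rings and Ulm factors\<close>

definition lexless :: "(nat \<Rightarrow> int) \<Rightarrow> (nat \<Rightarrow> int) \<Rightarrow> bool" where
  "lexless x y \<longleftrightarrow> (\<exists>i. x i < y i \<and> (\<forall>j<i. x j = y j))"

lemma lexless_irrefl: "\<not> lexless x x"
  by (simp add: lexless_def)

lemma lexless_trans:
  assumes "lexless x y" "lexless y z"
  shows "lexless x z"
proof -
  obtain i where i: "x i < y i" "\<And>j. j < i \<Longrightarrow> x j = y j" using assms(1) by (auto simp: lexless_def)
  obtain i' where i': "y i' < z i'" "\<And>j. j < i' \<Longrightarrow> y j = z j" using assms(2) by (auto simp: lexless_def)
  have "x (min i i') < z (min i i')"
    using i i' by (cases i i' rule: linorder_cases) (auto simp: min_def)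
  moreover have "\<forall>j<min i i'. x j = z j" using i i' by simp
  ultimately show ?thesis by (auto simp: lexless_def)
qed

lemma lexless_total:
  assumes "x \<noteq> y"
  shows "lexless x y \<or> lexless y x"
proof -
  define i where "i = (LEAST i. x i \<noteq> y i)"
  have "\<exists>i. x i \<noteq> y i" using assms by auto
  then have "x i \<noteq> y i" unfolding i_def by (rule LeastI_ex)
  then have "x i < y i \<or> y i < x i" by linarith
  moreover have "x j = y j" if "j < i" for j
    using not_less_Least[OF that[unfolded i_def]] by simp
  ultimately show ?thesis unfolding lexless_def by auto
qed

lemma lexless_add: "lexless x y \<Longrightarrow> lexless (x + z) (y + z)"
  by (auto simp: lexless_def pointwise)

text \<open>Replacing a maximum by a smaller element strictly lowers the sum, so the sum of the two
  maxima is represented once. The order is a parameter because both \<open>lexless\<close> and its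
  converse are needed.\<close>

lemma extremal_sum_unique:
  fixes T T' :: "(nat \<Rightarrow> int) set"
  assumes irrefl: "\<And>x. \<not> r x x" and trans: "\<And>x y z. r x y \<Longrightarrow> r y z \<Longrightarrow> r x z"
    and total: "\<And>x y. x \<noteq> y \<Longrightarrow> r x y \<or> r y x"
    and add: "\<And>x y z. r x y \<Longrightarrow> r (x + z) (y + z)"
    and T: "finite T" "T \<noteq> {}" and T': "finite T'" "T' \<noteq> {}"
  obtains t t' where "t \<in> T" "t' \<in> T'" "\<And>s. s \<in> T \<Longrightarrow> s \<noteq> t \<Longrightarrow> r s t" "\<And>s. s \<in> T' \<Longrightarrow> s \<noteq> t' \<Longrightarrow> r s t'"
    "\<And>s s'. s \<in> T \<Longrightarrow> s' \<in> T' \<Longrightarrow> s + s' = t + t' \<Longrightarrow> s = t \<and> s' = t'"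
proof -
  have max: "\<exists>t\<in>S. \<forall>s\<in>S. s \<noteq> t \<longrightarrow> r s t" if "finite S" "S \<noteq> {}" for S
    using that
  proof (induction rule: finite_ne_induct)
    case (insert x S)
    then obtain t where t: "t \<in> S" "\<forall>s\<in>S. s \<noteq> t \<longrightarrow> r s t" by blast
    show ?case
    proof (cases "r t x")
      case True
      have "r s x" if "s \<in> S" for s
        using that t(2) True trans[of s t x] by (cases "s = t") simp_all
      then show ?thesis by auto
    next
      case False
      moreover have "x \<noteq> t" using t insert by blast
      ultimately have "r x t" using total[of x t] by blast
      then show ?thesis using t by auto
    qed
  qed simp
  obtain t where t: "t \<in> T" "\<And>s. s \<in> T \<Longrightarrow> s \<noteq> t \<Longrightarrow> r s t" using max[OF T] by blast
  obtain t' where t': "t' \<in> T'" "\<And>s. s \<in> T' \<Longrightarrow> s \<noteq> t' \<Longrightarrow> r s t'" using max[OF T'] by blast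
  show thesis
  proof (rule that[OF t(1) t'(1) t(2) t'(2)])
    fix s s' assume s: "s \<in> T" "s' \<in> T'" "s + s' = t + t'"
    show "s = t \<and> s' = t'"
    proof (cases "s = t")
      case True
      then show ?thesis using s by simp
    next
      case False
      then have 1: "r (s + s') (t + s')" using t(2) s(1) by (intro add)
      have 2: "r (s' + t) (t' + t)" if "s' \<noteq> t'" using t'(2) s(2) that by (intro add)
      have "r (s + s') (t + t')"
        using 1 2 trans[of "s + s'" "t + s'" "t + t'"] by (cases "s' = t'") (simp_all add: add.commute)
      then show ?thesis using s(3) irrefl by simp
    qed
  qed
qed

text \<open>
  With \<open>T\<close> and \<open>T'\<close> the supports of a unit and its inverse, a uniquely represented sum contributes a
  nonzero coefficient to the product 1.
\<close>

lemma unique_sum_singleton: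
  fixes T T' :: "(nat \<Rightarrow> int) set"
  assumes T: "finite T" "T \<noteq> {}" and T': "finite T'" "T' \<noteq> {}"
    and zero: "\<And>t t'. t \<in> T \<Longrightarrow> t' \<in> T' \<Longrightarrow>
      (\<And>s s'. s \<in> T \<Longrightarrow> s' \<in> T' \<Longrightarrow> s + s' = t + t' \<Longrightarrow> s = t \<and> s' = t') \<Longrightarrow> t + t' = 0"
  shows "\<exists>m. T = {m}"
proof (rule extremal_sum_unique[where r = lexless, OF lexless_irrefl lexless_trans lexless_total lexless_add T T'])
  fix t t'
  assume t: "t \<in> T" "t' \<in> T'" "\<And>s. s \<in> T \<Longrightarrow> s \<noteq> t \<Longrightarrow> lexless s t"
    "\<And>s s'. s \<in> T \<Longrightarrow> s' \<in> T' \<Longrightarrow> s + s' = t + t' \<Longrightarrow> s = t \<and> s' = t'"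
  have trans': "lexless z x" if "lexless y x" "lexless z y" for x y z
    using that(2,1) by (rule lexless_trans)
  have total': "lexless y x \<or> lexless x y" if "x \<noteq> y" for x y
    using lexless_total[OF that[symmetric]] .
  have add': "lexless (y + z) (x + z)" if "lexless y x" for x y z
    using that by (rule lexless_add)
  show ?thesis
  proof (rule extremal_sum_unique[of "\<lambda>x y. lexless y x" T T'])
    show "\<not> lexless x x" for x by (rule lexless_irrefl)
    show "lexless z x" if "lexless y x" "lexless z y" for x y z using that by (rule trans')
    show "lexless y x \<or> lexless x y" if "x \<noteq> y" for x y using that by (rule total')
    show "lexless (y + z) (x + z)" if "lexless y x" for x y z using that by (rule add')
    show "finite T" "T \<noteq> {}" "finite T'" "T' \<noteq> {}" by (fact T T')+
  next
    fix u u'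
    assume u: "u \<in> T" "u' \<in> T'" "\<And>s. s \<in> T \<Longrightarrow> s \<noteq> u \<Longrightarrow> lexless u s"
      "\<And>s s'. s \<in> T \<Longrightarrow> s' \<in> T' \<Longrightarrow> s + s' = u + u' \<Longrightarrow> s = u \<and> s' = u'"
    \<comment> \<open>Maxima and minima both add up to 0, so uniqueness identifies the maximum of
      \<open>T\<close> with its minimum.\<close>
    have "t + t' = 0" using t(1,2,4) by (rule zero)
    moreover have "u + u' = 0" using u(1,2,4) by (rule zero)
    ultimately have "u = t" using t(4)[OF u(1,2)] by simp
    have "T = {t}"
    proof (rule ccontr)
      assume "T \<noteq> {t}"
      then obtain s where "s \<in> T" "s \<noteq> t" using t by blast
      then have "lexless s t" "lexless t s" using t(3) u(3) \<open>u = t\<close> by auto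
      then show False using lexless_trans[of s t s] lexless_irrefl by blast
    qed
    then show ?thesis by blast
  qed
qed

text \<open>This is \<open>q^a G\<close> intersected with \<open>G[q]\<close>, written
  multiplicatively. For a prime \<open>q\<close>, the dimension of the quotient of the set for
  \<open>r - 1\<close> by that for \<open>r\<close> counts the cyclic summands of order
  \<open>q ^ r\<close>.\<close>

definition ulm_set :: "('a, 'b) monoid_scheme \<Rightarrow> nat \<Rightarrow> nat \<Rightarrow> 'a set" where
  "ulm_set G q a = {g \<in> carrier G. (\<exists>h\<in>carrier G. g = h [^]\<^bsub>G\<^esub> (q ^ a)) \<and> g [^]\<^bsub>G\<^esub> q = \<one>\<^bsub>G\<^esub>}"

lemma pow_product_group:
  assumes "x \<in> carrier (product_group I F)" "\<And>i. i \<in> I \<Longrightarrow> group (F i)"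
  shows "x [^]\<^bsub>product_group I F\<^esub> (m::nat) = (\<lambda>i\<in>I. x i [^]\<^bsub>F i\<^esub> m)"
proof (induction m)
  case 0
  interpret group "product_group I F" using assms(2) by simp
  show ?case using nat_pow_0[of x] by (simp add: fun_eq_iff group.is_monoid[OF assms(2)] monoid.nat_pow_0 cong: restrict_cong)
next
  case (Suc m)
  interpret group "product_group I F" using assms(2) by simp
  show ?case using nat_pow_Suc[of x m] Suc
    by (simp add: fun_eq_iff group.is_monoid[OF assms(2)] monoid.nat_pow_Suc cong: restrict_cong)
qed

text \<open>
  The character \<open>\<tau>\<close> of the summand of multiplicity one identifies \<open>ulm_set G p (r - 1)\<close> modulo
  \<open>ulm_set G p r\<close> with the \<open>p\<close>-th roots of unity.
\<close>

lemma ulm_character: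
  fixes G :: "('a, 'b) monoid_scheme" and p r d :: "nat \<Rightarrow> nat"
  assumes G: "comm_group G" "finite (carrier G)"
    and pr: "\<forall>i<n. Factorial_Ring.prime (p i) \<and> r i \<ge> 1 \<and> d i \<ge> 1"
    and dist: "\<forall>i<n. \<forall>j<n. i \<noteq> j \<longrightarrow> (p i, r i) \<noteq> (p j, r j)"
    and iso: "G \<cong> product_group {(i, j). i < n \<and> j < d i} (\<lambda>(i, j). integer_mod_group (p i ^ r i))"
    and i0: "i0 < n" "d i0 = 1"
  obtains \<tau> :: "'a \<Rightarrow> complex" and s where
    "\<And>g h. g \<in> carrier G \<Longrightarrow> h \<in> carrier G \<Longrightarrow> \<tau> (g \<otimes>\<^bsub>G\<^esub> h) = \<tau> g * \<tau> h"
    "\<And>g. \<tau> g \<noteq> 0"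
    "\<And>g. g \<in> ulm_set G (p i0) (r i0 - 1) \<Longrightarrow> \<tau> g = 1 \<Longrightarrow> g \<in> ulm_set G (p i0) (r i0)"
    "\<And>g. g \<in> ulm_set G (p i0) (r i0) \<Longrightarrow> \<tau> g = 1"
    "s \<in> ulm_set G (p i0) (r i0 - 1)" "\<tau> s = cis (2 * pi / p i0)"
proof -
  interpret G: comm_group G by fact
  define I where "I = {(i, j). i < n \<and> j < d i}"
  define F where "F = (\<lambda>(i, j :: nat). integer_mod_group (p i ^ r i))"
  define H where "H = product_group I F"
  have F: "group (F x)" for x by (auto simp: F_def split: prod.split)
  interpret H: group H unfolding H_def using F by simp
  obtain \<iota> where \<iota>: "\<iota> \<in> iso G H" using iso by (auto simp: is_iso_def H_def I_def F_def)
  then interpret \<iota>: group_hom G H \<iota> by unfold_locales (simp add: iso_def)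
  have bij: "bij_betw \<iota> (carrier G) (carrier H)" using \<iota> by (simp add: iso_def)
  define o0 where "o0 = (i0, 0::nat)"
  define q where "q = p i0"
  define R where "R = r i0"
  have q: "Factorial_Ring.prime q" "R \<ge> 1" using pr i0 by (auto simp: q_def R_def)
  have qR: "q ^ R = q * q ^ (R - 1)" using q by (cases R) auto
  have q2: "q \<ge> 2" using q prime_ge_2_nat by blast
  have pp: "p i ^ r i > 0" if "i < n" for i
    using pr that prime_gt_0_nat by simp
  have o0: "o0 \<in> I" using i0 by (simp add: o0_def I_def)
  have Ho0: "x o0 \<in> {0..<int (q ^ R)}" if "x \<in> carrier H" for x
    using that o0 pp[OF i0(1)] by (auto simp: H_def F_def o0_def q_def R_def carrier_integer_mod_group dest: PiE_mem)
  \<comment> \<open>The coordinate in the summand of multiplicity one; \<open>\<tau>\<close> is the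
    standard faithful character of that summand, pulled back to \<open>G\<close>.\<close>
  define \<kappa> where "\<kappa> g = \<iota> g o0" for g
  define \<tau> where "\<tau> g = cis (2 * pi * of_int (\<kappa> g) / of_nat (q ^ R))" for g
  have qRpos: "0 < int (q ^ R)" using q2 by simp
  have nz: "real (q ^ R) \<noteq> 0" using q2 by simp
  have cis_mod: "cis (2 * pi * of_int (a mod int (q ^ R)) / of_nat (q ^ R)) = cis (2 * pi * of_int a / of_nat (q ^ R))" for a
  proof -
    have "real_of_int a = of_int (int (q ^ R) * (a div int (q ^ R)) + a mod int (q ^ R))"
      by (simp only: mult_div_mod_eq)
    also have "\<dots> = real (q ^ R) * of_int (a div int (q ^ R)) + of_int (a mod int (q ^ R))"
      by (simp only: of_int_add of_int_mult of_int_of_nat_eq)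
    finally have "2 * pi * of_int a / of_nat (q ^ R)
        = 2 * pi * of_int (a div int (q ^ R)) + 2 * pi * of_int (a mod int (q ^ R)) / of_nat (q ^ R)"
      using nz by (simp only: ring_distribs add_divide_distrib) (simp add: field_simps)
    then show ?thesis by (simp add: cis_mult[symmetric] cis_multiple_2pi del: of_nat_power)
  qed
  have hom: "\<tau> (g \<otimes>\<^bsub>G\<^esub> h) = \<tau> g * \<tau> h" if "g \<in> carrier G" "h \<in> carrier G" for g h
  proof -
    have "\<kappa> (g \<otimes>\<^bsub>G\<^esub> h) = (\<kappa> g + \<kappa> h) mod int (q ^ R)"
      using that o0 by (simp add: \<kappa>_def \<iota>.hom_mult) (simp add: H_def F_def o0_def q_def R_def)
    then show ?thesis
      by (simp only: \<tau>_def cis_mod cis_mult) (simp add: ring_distribs add_divide_distrib)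
  qed
  have one: "\<tau> \<one>\<^bsub>G\<^esub> = 1" using o0 by (simp add: \<tau>_def \<kappa>_def) (simp add: H_def F_def o0_def)
  have pow: "\<tau> (g [^]\<^bsub>G\<^esub> (m::nat)) = \<tau> g ^ m" if "g \<in> carrier G" for g m
    using that by (induction m) (auto simp: one hom)
  have root: "\<tau> g ^ (q ^ R) = 1" for g
  proof -
    have "\<tau> g ^ (q ^ R) = cis (real (q ^ R) * (2 * pi * of_int (\<kappa> g) / of_nat (q ^ R)))"
      by (simp only: \<tau>_def DeMoivre)
    also have "real (q ^ R) * (2 * pi * of_int (\<kappa> g) / of_nat (q ^ R)) = 2 * pi * of_int (\<kappa> g)"
      using nz by (simp del: of_nat_power)
    finally show ?thesis by (simp add: cis_multiple_2pi)
  qed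
  have \<iota>pow: "\<iota> (g [^]\<^bsub>G\<^esub> (m::nat)) x = (if fst x < n \<and> snd x < d (fst x) then int m * \<iota> g x mod int (p (fst x) ^ r (fst x)) else undefined)"
    if "g \<in> carrier G" for g m x
  proof -
    have "\<iota> (g [^]\<^bsub>G\<^esub> m) = \<iota> g [^]\<^bsub>H\<^esub> m" using that by (rule \<iota>.hom_nat_pow)
    also have "\<dots> = (\<lambda>i\<in>I. \<iota> g i [^]\<^bsub>F i\<^esub> m)"
      unfolding H_def using that F \<iota>.hom_closed[OF that] by (intro pow_product_group) (auto simp: H_def)
    finally show ?thesis by (cases x) (auto simp: I_def F_def)
  qed
  have inj: "g = h" if "g \<in> carrier G" "h \<in> carrier G" "\<And>x. x \<in> I \<Longrightarrow> \<iota> g x = \<iota> h x" for g h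
  proof -
    have "\<iota> g = \<iota> h"
    proof (rule PiE_ext)
      show "\<iota> g \<in> (\<Pi>\<^sub>E i\<in>I. carrier (F i))" "\<iota> h \<in> (\<Pi>\<^sub>E i\<in>I. carrier (F i))"
        using \<iota>.hom_closed[OF that(1)] \<iota>.hom_closed[OF that(2)] by (simp_all add: H_def)
    qed (rule that(3))
    then show ?thesis using bij that by (auto simp: bij_betw_def inj_on_def)
  qed
  have surj: "\<exists>g\<in>carrier G. \<forall>x\<in>I. \<iota> g x = f x"
    if "\<And>i j. i < n \<Longrightarrow> j < d i \<Longrightarrow> 0 \<le> f (i, j) \<and> f (i, j) < int (p i ^ r i)" for f
  proof -
    have "restrict f I \<in> carrier H"
      using that pp by (auto simp: H_def I_def F_def carrier_integer_mod_group)
    then have "restrict f I \<in> \<iota> ` carrier G" using bij by (simp add: bij_betw_def)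
    then obtain g where "restrict f I = \<iota> g" "g \<in> carrier G" by (rule imageE)
    then have "g \<in> carrier G" "\<iota> g = restrict f I" by simp_all
    then show ?thesis by (intro bexI[of _ g]) simp_all
  qed
  have range: "0 \<le> \<iota> g (i, j) \<and> \<iota> g (i, j) < int (p i ^ r i)" if "g \<in> carrier G" "i < n" "j < d i" for g i j
  proof -
    have "\<iota> g (i, j) \<in> carrier (F (i, j))"
      using \<iota>.hom_closed[OF that(1)] that(2,3) by (auto simp: H_def I_def dest: PiE_mem)
    then show ?thesis using pp[OF that(2)] by (auto simp: F_def carrier_integer_mod_group split: if_splits)
  qed
  have \<iota>1: "\<iota> \<one>\<^bsub>G\<^esub> x = 0" if "x \<in> I" for x
    using that by (simp add: H_def F_def split: prod.split)
  have ulm_Suc: "g \<in> ulm_set G q R" if g: "g \<in> ulm_set G q (R - 1)" and g1: "\<tau> g = 1" for g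
  proof -
    obtain h where h: "h \<in> carrier G" "g = h [^]\<^bsub>G\<^esub> (q ^ (R - 1))" and gG: "g \<in> carrier G" and gq: "g [^]\<^bsub>G\<^esub> q = \<one>\<^bsub>G\<^esub>"
      using g by (auto simp: ulm_set_def)
    have \<kappa>0: "\<kappa> g = 0"
    proof -
      have \<kappa>: "0 \<le> \<kappa> g" "\<kappa> g < int (q ^ R)"
        using Ho0[OF \<iota>.hom_closed[OF gG]] by (auto simp: \<kappa>_def)
      have "inj_on (\<lambda>k. cis (2 * pi * real k / real (q ^ R))) {..<q ^ R}"
        using bij_betw_roots_unity[of "q ^ R"] q2 by (simp add: bij_betw_def)
      moreover have "cis (2 * pi * real (nat (\<kappa> g)) / real (q ^ R)) = cis (2 * pi * real 0 / real (q ^ R))"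
        using g1 \<kappa> by (simp add: \<tau>_def)
      moreover have "nat (\<kappa> g) \<in> {..<q ^ R}" "0 \<in> {..<q ^ R}"
        using \<kappa> q2 by (simp_all add: nat_less_iff)
      ultimately have "nat (\<kappa> g) = 0" by (rule inj_onD)
      then show ?thesis using \<kappa> by simp
    qed
    have dvd: "int (q ^ R) dvd \<iota> g (i, j)" if ij: "i < n" "j < d i" for i j
    proof -
      let ?x = "\<iota> g (i, j)" and ?m = "p i ^ r i"
      have xr: "0 \<le> ?x" "?x < int ?m" using range gG ij by auto
      have x0: "?x = 0" if "int ?m dvd ?x"
      proof (rule ccontr)
        assume "?x \<noteq> 0"
        then have "int ?m \<le> ?x" using xr(1) by (intro zdvd_imp_le[OF that]) linarith
        then show False using xr(2) by linarith
      qed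
      have xh: "?x = int (q ^ (R - 1)) * \<iota> h (i, j) mod int ?m"
        using \<iota>pow[OF h(1), of "q ^ (R - 1)" "(i, j)"] ij by (simp add: h(2))
      have xq: "int ?m dvd int q * ?x"
        using \<iota>pow[OF gG, of q "(i, j)"] ij \<iota>1[of "(i, j)"] by (simp add: gq I_def mod_eq_0_iff_dvd)
      have pi: "Factorial_Ring.prime (p i)" using pr ij by blast
      \<comment> \<open>Multiplicity one enters here: every other summand has another prime or
        another exponent. For another prime, \<open>q\<close>-torsion is trivial; for a smaller
        exponent, \<open>q ^ (R - 1)\<close> kills the summand; for a larger one,
        \<open>q\<close>-torsion is divisible by \<open>q ^ R\<close>.\<close>
      consider "(i, j) = o0" | "p i \<noteq> q" | "p i = q" "r i < R" | "p i = q" "R < r i"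
      proof (cases "i = i0")
        case True
        then have "j = 0" using ij i0 by simp
        then show ?thesis using that(1) True by (simp add: o0_def)
      next
        case False
        then have "p i \<noteq> q \<or> r i \<noteq> R" using dist i0 ij by (auto simp: q_def R_def)
        then show ?thesis using that(2-4) by linarith
      qed
      then show ?thesis
      proof cases
        case 1
        then show ?thesis using \<kappa>0 by (simp add: \<kappa>_def)
      next
        case 2
        then have "coprime ?m q" using pi q by (simp add: primes_coprime)
        then have "coprime (int ?m) (int q)" by (simp only: coprime_int_iff)
        then have "int ?m dvd ?x" using xq by (simp only: coprime_dvd_mult_right_iff)
        then show ?thesis using x0 by simp
      next
        case 3
        then have "?m dvd q ^ (R - 1)" by (simp add: le_imp_power_dvd)
        then have "int ?m dvd int (q ^ (R - 1))" by (simp only: int_dvd_int_iff)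
        then have "int ?m dvd ?x" unfolding xh by (intro dvd_mod dvd_mult2 dvd_refl)
        then show ?thesis using x0 by simp
      next
        case 4
        then have "int ?m = int q * int (q ^ (r i - 1))" by (cases "r i") auto
        then have "int (q ^ (r i - 1)) dvd ?x" using xq q2 by simp
        moreover have "q ^ R dvd q ^ (r i - 1)" using 4 by (simp add: le_imp_power_dvd)
        then have "int (q ^ R) dvd int (q ^ (r i - 1))" by (simp only: int_dvd_int_iff)
        ultimately show ?thesis using dvd_trans by blast
      qed
    qed
    \<comment> \<open>Dividing all coordinates by \<open>q ^ R\<close> gives a root of
      \<open>g\<close> of that order.\<close>
    obtain y where y: "y \<in> carrier G" "\<And>x. x \<in> I \<Longrightarrow> \<iota> y x = \<iota> g x div int (q ^ R)"
    proof -
      have "0 \<le> \<iota> g (i, j) div int (q ^ R) \<and> \<iota> g (i, j) div int (q ^ R) < int (p i ^ r i)" if "i < n" "j < d i" for i j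
      proof -
        have "\<iota> g (i, j) div int (q ^ R) \<le> \<iota> g (i, j)"
        proof -
          have "1 \<le> int (q ^ R)" using qRpos by linarith
          from zdiv_mono2[OF _ _ this, of "\<iota> g (i, j)"] range[OF gG that] show ?thesis by simp
        qed
        moreover have "0 \<le> \<iota> g (i, j) div int (q ^ R)"
          using pos_imp_zdiv_nonneg_iff[of "int (q ^ R)"] range[OF gG that] qRpos by blast
        ultimately show ?thesis using range[OF gG that] by linarith
      qed
      then show ?thesis using surj[of "\<lambda>x. \<iota> g x div int (q ^ R)"] that by blast
    qed
    have "g = y [^]\<^bsub>G\<^esub> (q ^ R)"
    proof (rule inj)
      fix x assume x: "x \<in> I"
      then obtain i j where ij: "x = (i, j)" "i < n" "j < d i" by (auto simp: I_def)
      have "int (q ^ R) * \<iota> y x = \<iota> g x"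
        unfolding y(2)[OF x] using dvd[OF ij(2,3)] unfolding ij(1) by (rule dvd_mult_div_cancel)
      then show "\<iota> g x = \<iota> (y [^]\<^bsub>G\<^esub> (q ^ R)) x"
        using range[OF gG ij(2,3)] ij by (simp only: \<iota>pow[OF y(1)]) simp
    qed (use gG y in auto)
    then show ?thesis using y gG gq by (auto simp: ulm_set_def)
  qed
  obtain u where u: "u \<in> carrier G" "\<And>x. x \<in> I \<Longrightarrow> \<iota> u x = (if x = o0 then 1 else 0)"
  proof -
    have "1 < int (q ^ R)" using q2 q by (simp add: one_less_power)
    then have "0 \<le> (if (i, j) = o0 then 1 else 0 :: int) \<and> (if (i, j) = o0 then 1 else 0) < int (p i ^ r i)"
      if "i < n" "j < d i" for i j
      using pp[OF that(1)] by (simp only: o0_def q_def R_def split: if_splits) simp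
    then show ?thesis using surj[of "\<lambda>x. if x = o0 then 1 else 0"] that by blast
  qed
  \<comment> \<open>\<open>u\<close> generates the distinguished summand, so \<open>s\<close>
    generates its subgroup of order \<open>q\<close>.\<close>
  define s where "s = u [^]\<^bsub>G\<^esub> (q ^ (R - 1))"
  have sG: "s \<in> carrier G" using u by (simp add: s_def)
  have \<tau>u: "\<tau> u = cis (2 * pi / real (q ^ R))" using u o0 by (simp add: \<tau>_def \<kappa>_def)
  have \<tau>s: "\<tau> s = cis (2 * pi / real q)"
  proof -
    have "\<tau> s = cis (real (q ^ (R - 1)) * (2 * pi / real (q ^ R)))"
      by (simp only: s_def pow[OF u(1)] \<tau>u DeMoivre)
    also have "real (q ^ (R - 1)) * (2 * pi / real (q ^ R)) = 2 * pi / real q"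
      using q2 by (simp add: qR)
    finally show ?thesis .
  qed
  have sq: "s [^]\<^bsub>G\<^esub> q = \<one>\<^bsub>G\<^esub>"
  proof (rule inj)
    fix x assume x: "x \<in> I"
    have "s [^]\<^bsub>G\<^esub> q = u [^]\<^bsub>G\<^esub> (q ^ R)" using u by (simp add: s_def G.nat_pow_pow qR mult.commute)
    then show "\<iota> (s [^]\<^bsub>G\<^esub> q) x = \<iota> \<one>\<^bsub>G\<^esub> x"
      unfolding \<iota>1[OF x] using x
      by (auto simp: \<iota>pow[OF u(1)] u(2)[OF x] I_def o0_def q_def R_def)
  qed (use sG in auto)
  have sP: "s \<in> ulm_set G q (R - 1)" using sq sG u by (auto simp: ulm_set_def s_def)
  have ulm1: "\<tau> g = 1" if "g \<in> ulm_set G q R" for g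
    using that pow root by (auto simp: ulm_set_def)
  have "\<tau> g \<noteq> 0" for g by (simp add: \<tau>_def)
  from that[OF hom this ulm_Suc[unfolded q_def R_def] ulm1[unfolded q_def R_def] sP[unfolded q_def R_def] \<tau>s[unfolded q_def]]
  show thesis .
qed

section \<open>The base group and its characters\<close>

definition shift :: "(nat \<Rightarrow> int) \<Rightarrow> ((nat \<Rightarrow> int) \<Rightarrow> 'a) \<Rightarrow> (nat \<Rightarrow> int) \<Rightarrow> 'a" where
  "shift x f = (\<lambda>z. f (z - x))"

lemma shift_shift: "shift x (shift y f) = shift (x + y) f"
  by (simp add: shift_def fun_eq_iff diff_diff_eq)

lemma shift_0 [simp]: "shift 0 f = f"
  by (simp add: shift_def)

locale lamps = G: comm_group G for G :: "('a, 'b) monoid_scheme" (structure) +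
  fixes k :: nat
  assumes fin: "finite (carrier G)"
begin

definition Sig :: "((nat \<Rightarrow> int) \<Rightarrow> 'a) set" where
  "Sig = {f. (\<forall>y. f y \<in> carrier G) \<and> finite {y. f y \<noteq> \<one>} \<and> (\<forall>y. y \<notin> lattice k \<longrightarrow> f y = \<one>)}"

definition mulf :: "((nat \<Rightarrow> int) \<Rightarrow> 'a) \<Rightarrow> ((nat \<Rightarrow> int) \<Rightarrow> 'a) \<Rightarrow> (nat \<Rightarrow> int) \<Rightarrow> 'a" (infixl "\<odot>" 70) where
  "f \<odot> g = (\<lambda>z. f z \<otimes> g z)"

definition powf :: "((nat \<Rightarrow> int) \<Rightarrow> 'a) \<Rightarrow> nat \<Rightarrow> (nat \<Rightarrow> int) \<Rightarrow> 'a" where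
  "powf f m = (\<lambda>z. f z [^] m)"

definition onef :: "(nat \<Rightarrow> int) \<Rightarrow> 'a" where
  "onef = (\<lambda>_. \<one>)"

definition delta :: "(nat \<Rightarrow> int) \<Rightarrow> 'a \<Rightarrow> (nat \<Rightarrow> int) \<Rightarrow> 'a" where
  "delta x g = (\<lambda>z. if z = x then g else \<one>)"

definition val :: "'a set \<Rightarrow> ((nat \<Rightarrow> int) \<Rightarrow> 'a) set" where
  "val S = {f \<in> Sig. \<forall>z. f z \<in> S}"

text \<open>A homomorphism from \<open>Sig\<close> to the nonzero complex numbers; the values
  outside \<open>Sig\<close> are arbitrary.\<close>

definition character :: "(((nat \<Rightarrow> int) \<Rightarrow> 'a) \<Rightarrow> complex) \<Rightarrow> bool" where
  "character \<chi> \<longleftrightarrow> (\<forall>f\<in>Sig. \<forall>g\<in>Sig. \<chi> (f \<odot> g) = \<chi> f * \<chi> g) \<and> (\<forall>f\<in>Sig. \<chi> f \<noteq> 0)"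

lemma Sig_carrier: "f \<in> Sig \<Longrightarrow> f z \<in> carrier G"
  and Sig_finite: "f \<in> Sig \<Longrightarrow> finite {y. f y \<noteq> \<one>}"
  and Sig_out: "f \<in> Sig \<Longrightarrow> z \<notin> lattice k \<Longrightarrow> f z = \<one>"
  by (auto simp: Sig_def)

lemma onef_Sig [simp]: "onef \<in> Sig"
  by (simp add: Sig_def onef_def)

lemma mulf_Sig [simp]: "f \<in> Sig \<Longrightarrow> g \<in> Sig \<Longrightarrow> f \<odot> g \<in> Sig"
  unfolding Sig_def mulf_def
  by (auto intro: finite_subset[of _ "{y. f y \<noteq> \<one>} \<union> {y. g y \<noteq> \<one>}"])

lemma powf_Sig [simp]: "f \<in> Sig \<Longrightarrow> powf f m \<in> Sig"
  unfolding Sig_def powf_def by (auto intro: finite_subset[of _ "{y. f y \<noteq> \<one>}"])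

lemma delta_Sig [simp]: "x \<in> lattice k \<Longrightarrow> g \<in> carrier G \<Longrightarrow> delta x g \<in> Sig"
  unfolding Sig_def delta_def by (auto intro: finite_subset[of _ "{x}"])

lemma delta_one [simp]: "delta x \<one> = onef"
  by (auto simp: delta_def onef_def)

lemma shift_Sig [simp]:
  assumes "x \<in> lattice k" "f \<in> Sig"
  shows "shift x f \<in> Sig"
proof -
  have "{y. f (y - x) \<noteq> \<one>} \<subseteq> (\<lambda>y. y + x) ` {y. f y \<noteq> \<one>}"
    by (auto intro!: image_eqI[of _ _ "_ - x"])
  then have "finite {y. f (y - x) \<noteq> \<one>}"
    using Sig_finite[OF assms(2)] finite_surj by blast
  moreover have "f (y - x) = \<one>" if "y \<notin> lattice k" for y
  proof -
    have "y - x \<notin> lattice k" using that lattice_add[OF _ assms(1), of "y - x"] by auto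
    then show ?thesis using assms(2) Sig_out by simp
  qed
  ultimately show ?thesis using assms(2) by (simp add: Sig_def shift_def)
qed

lemma shift_delta: "shift x (delta y g) = delta (x + y) g"
  by (simp add: shift_def delta_def diff_eq_eq add.commute[of y x])

lemma shift_mulf: "shift x (f \<odot> g) = shift x f \<odot> shift x g"
  by (simp add: shift_def mulf_def)

lemma mulf_onef [simp]: "f \<in> Sig \<Longrightarrow> onef \<odot> f = f" "f \<in> Sig \<Longrightarrow> f \<odot> onef = f"
  by (simp_all add: mulf_def onef_def Sig_def)

lemma mulf_cancel: "f \<in> Sig \<Longrightarrow> g \<in> Sig \<Longrightarrow> h \<in> Sig \<Longrightarrow> f \<odot> h = g \<odot> h \<Longrightarrow> f = g"
  by (rule ext, drule fun_cong) (simp add: mulf_def Sig_def)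

lemma mulf_commute: "f \<in> Sig \<Longrightarrow> g \<in> Sig \<Longrightarrow> f \<odot> g = g \<odot> f"
  by (simp add: mulf_def Sig_def G.m_comm)

lemma powf_0: "powf f 0 = onef" and powf_Suc: "powf f (Suc m) = powf f m \<odot> f"
  by (simp_all add: powf_def onef_def mulf_def)

lemma Sig_induct [consumes 1, case_names one mult]:
  assumes "f \<in> Sig" and one: "P onef"
    and mult: "\<And>f x g. f \<in> Sig \<Longrightarrow> x \<in> lattice k \<Longrightarrow> g \<in> carrier G \<Longrightarrow> f x = \<one> \<Longrightarrow> P f \<Longrightarrow> P (delta x g \<odot> f)"
  shows "P f"
proof -
  have "P f" if "finite S" "f \<in> Sig" "{y. f y \<noteq> \<one>} = S" for S f
    using that
  proof (induction S arbitrary: f rule: finite_induct)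
    case empty
    then have "f = onef" by (auto simp: onef_def)
    then show ?case using one by simp
  next
    case (insert x S)
    define h where "h = f(x := \<one>)"
    have supp: "{y. h y \<noteq> \<one>} = S"
      using insert(2,5) unfolding h_def by auto
    then have h: "h \<in> Sig"
      using insert(1,4) by (auto simp: Sig_def h_def)
    have "f x \<noteq> \<one>" using insert(5) by auto
    then have "x \<in> lattice k" using Sig_out insert(4) by blast
    then have "P (delta x (f x) \<odot> h)"
      using Sig_carrier[OF insert(4)] h insert.IH[OF h supp] by (intro mult) (simp_all, simp add: h_def)
    also have "delta x (f x) \<odot> h = f"
    proof
      fix y show "(delta x (f x) \<odot> h) y = f y"
        using Sig_carrier[OF insert(4)] by (cases "y = x") (simp_all add: delta_def mulf_def h_def)
    qed
    finally show ?case .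
  qed
  then show ?thesis using assms(1) Sig_finite by blast
qed

lemma character_mult: "character \<chi> \<Longrightarrow> f \<in> Sig \<Longrightarrow> g \<in> Sig \<Longrightarrow> \<chi> (f \<odot> g) = \<chi> f * \<chi> g"
  and character_nz: "character \<chi> \<Longrightarrow> f \<in> Sig \<Longrightarrow> \<chi> f \<noteq> 0"
  by (auto simp: character_def)

lemma character_one: "character \<chi> \<Longrightarrow> \<chi> onef = 1"
  using character_mult[of \<chi> onef onef] character_nz[of \<chi> onef] by simp

lemma character_pow: "character \<chi> \<Longrightarrow> f \<in> Sig \<Longrightarrow> \<chi> (powf f m) = \<chi> f ^ m"
  by (induction m) (simp_all add: powf_0 powf_Suc character_one character_mult)

text \<open>A function in \<open>Sig\<close> is a finite product of point masses. The set
  \<open>S\<close> may exceed the support, so that one index set can serve several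
  functions.\<close>

lemma character_decomp:
  assumes "character \<chi>" "f \<in> Sig" "finite S" "{y. f y \<noteq> \<one>} \<subseteq> S"
  shows "\<chi> f = (\<Prod>x\<in>S. \<chi> (delta x (f x)))"
  using assms(2,4)
proof (induction f rule: Sig_induct)
  case one
  have "delta x (onef x) = onef" for x
    using delta_one[of x] by (simp only: onef_def)
  then show ?case using assms(1) by (simp add: character_one)
next
  case (mult f x g)
  show ?case
  proof (cases "g = \<one>")
    case True
    then show ?thesis using mult by simp
  next
    case False
    have fG: "f y \<in> carrier G" for y using mult(1) by (rule Sig_carrier)
    have "(delta x g \<odot> f) x \<noteq> \<one>" using mult False by (simp add: delta_def mulf_def)
    then have xS: "x \<in> S" using mult.prems by blast
    have eq: "(delta x g \<odot> f) y = (if y = x then g else f y)" for y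
      using mult(2-4) fG by (simp add: delta_def mulf_def)
    have "{y. f y \<noteq> \<one>} \<subseteq> S"
    proof
      fix y assume "y \<in> {y. f y \<noteq> \<one>}"
      then have "(delta x g \<odot> f) y \<noteq> \<one>" using False by (simp add: eq)
      then show "y \<in> S" using mult.prems by blast
    qed
    then have IH: "\<chi> f = (\<Prod>x\<in>S. \<chi> (delta x (f x)))" by (rule mult.IH)
    have "\<chi> (delta x g \<odot> f) = \<chi> (delta x g) * \<chi> f"
      using mult assms(1) by (simp add: character_mult)
    also have "\<chi> f = \<chi> (delta x (f x)) * (\<Prod>y\<in>S - {x}. \<chi> (delta y (f y)))"
      unfolding IH using xS assms(3) by (simp add: prod.remove)
    also have "\<chi> (delta x (f x)) = 1" using mult assms(1) by (simp add: character_one)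
    also have "(\<Prod>y\<in>S - {x}. \<chi> (delta y (f y))) = (\<Prod>y\<in>S - {x}. \<chi> (delta y ((delta x g \<odot> f) y)))"
      by (rule prod.cong) (auto simp: eq)
    finally have "\<chi> (delta x g \<odot> f) = \<chi> (delta x g) * (\<Prod>y\<in>S - {x}. \<chi> (delta y ((delta x g \<odot> f) y)))"
      by simp
    moreover have "(delta x g \<odot> f) x = g" by (rule trans[OF eq]) simp
    ultimately show ?thesis using xS assms(3) by (simp add: prod.remove)
  qed
qed

lemma ulm_setD: "g \<in> ulm_set G q a \<Longrightarrow> g \<in> carrier G"
  by (simp add: ulm_set_def)

lemma ulm_one [simp]: "\<one> \<in> ulm_set G q a"
  by (auto simp: ulm_set_def intro!: bexI[of _ \<one>])

lemma ulm_mult: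
  assumes "g \<in> ulm_set G q a" "h \<in> ulm_set G q a"
  shows "g \<otimes> h \<in> ulm_set G q a"
proof -
  obtain g' h' where g': "g' \<in> carrier G" "g = g' [^] (q ^ a)" and h': "h' \<in> carrier G" "h = h' [^] (q ^ a)"
    using assms by (auto simp: ulm_set_def)
  have "g \<otimes> h = (g' \<otimes> h') [^] (q ^ a)" using g' h' by (simp add: G.nat_pow_distrib)
  moreover have "(g \<otimes> h) [^] q = \<one>" using assms by (auto simp: ulm_set_def G.nat_pow_distrib)
  ultimately show ?thesis using assms g' h' by (auto simp: ulm_set_def)
qed

lemma ulm_pow: "g \<in> ulm_set G q a \<Longrightarrow> g [^] (m::nat) \<in> ulm_set G q a"
  by (induction m) (auto intro: ulm_mult)

text \<open>The right-hand side uses only the group operations of \<open>Sig\<close>, so every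
  endomorphism of \<open>Sig\<close> preserves these subgroups.\<close>

lemma val_ulm_iff:
  "f \<in> val (ulm_set G q a) \<longleftrightarrow> f \<in> Sig \<and> (\<exists>h\<in>Sig. f = powf h (q ^ a)) \<and> powf f q = onef"
proof (intro iffI; (elim conjE bexE)?)
  assume f: "f \<in> val (ulm_set G q a)"
  then have "\<exists>h. h \<in> carrier G \<and> f z = h [^] (q ^ a)" for z by (auto simp: val_def ulm_set_def)
  then obtain h where "\<forall>z. h z \<in> carrier G \<and> f z = h z [^] (q ^ a)" using choice[of "\<lambda>z h. h \<in> carrier G \<and> f z = h [^] (q ^ a)"] by blast
  then have h: "\<And>z. h z \<in> carrier G" "\<And>z. f z = h z [^] (q ^ a)" by blast+
  \<comment> \<open>Roots are chosen pointwise; resetting them to the unit off the support of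
    \<open>f\<close> keeps the support finite.\<close>
  define h' where "h' z = (if f z = \<one> then \<one> else h z)" for z
  have "{y. h' y \<noteq> \<one>} \<subseteq> {y. f y \<noteq> \<one>}" by (auto simp: h'_def)
  moreover have "finite {y. f y \<noteq> \<one>}" using f Sig_finite by (simp add: val_def)
  ultimately have "finite {y. h' y \<noteq> \<one>}" by (rule finite_subset)
  then have "h' \<in> Sig" using f h(1) by (auto simp: Sig_def h'_def val_def)
  moreover have "f = powf h' (q ^ a)" by (rule ext) (simp add: powf_def h'_def flip: h(2))
  moreover have "powf f q = onef" using f by (simp add: powf_def onef_def val_def ulm_set_def)
  ultimately show "f \<in> Sig \<and> (\<exists>h\<in>Sig. f = powf h (q ^ a)) \<and> powf f q = onef"
    using f by (auto simp: val_def)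
next
  fix h assume f: "f \<in> Sig" "powf f q = onef" and h: "h \<in> Sig" "f = powf h (q ^ a)"
  have "f z \<in> ulm_set G q a" for z
    using fun_cong[OF f(2), of z] fun_cong[OF h(2), of z] Sig_carrier[OF f(1), of z] Sig_carrier[OF h(1), of z]
    by (auto simp: ulm_set_def powf_def onef_def)
  then show "f \<in> val (ulm_set G q a)" using f by (simp add: val_def)
qed

lemma delta_val: "x \<in> lattice k \<Longrightarrow> g \<in> ulm_set G q a \<Longrightarrow> delta x g \<in> val (ulm_set G q a)"
  using delta_Sig[of x g] ulm_setD[of g q a] by (simp add: val_def) (simp add: delta_def)

end

section \<open>Endomorphisms of the base group that are semilinear over the shifts\<close>

locale lamps_map = lamps + lattice_endo +
  fixes F :: "((nat \<Rightarrow> int) \<Rightarrow> 'a) \<Rightarrow> (nat \<Rightarrow> int) \<Rightarrow> 'a"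
  assumes F_closed [simp]: "f \<in> Sig \<Longrightarrow> F f \<in> Sig"
    and F_mult: "f \<in> Sig \<Longrightarrow> g \<in> Sig \<Longrightarrow> F (f \<odot> g) = F f \<odot> F g"
    and F_shift: "x \<in> lattice k \<Longrightarrow> f \<in> Sig \<Longrightarrow> F (shift x f) = shift (A x) (F f)"
begin

lemma F_one: "F onef = onef"
proof -
  have "onef \<odot> F onef = F onef \<odot> F onef" using F_mult[of onef onef] by simp
  then show ?thesis using mulf_cancel[of onef "F onef" "F onef"] by simp
qed

lemma F_pow: "f \<in> Sig \<Longrightarrow> F (powf f m) = powf (F f) m"
  by (induction m) (simp_all add: powf_0 powf_Suc F_one F_mult)

lemma F_val:
  assumes "f \<in> val (ulm_set G q a)"
  shows "F f \<in> val (ulm_set G q a)"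
proof -
  obtain h where h: "h \<in> Sig" "f = powf h (q ^ a)" and f: "f \<in> Sig" "powf f q = onef"
    using assms val_ulm_iff by blast
  have "F f = powf (F h) (q ^ a)" using F_pow[OF h(1)] h(2) by simp
  moreover have "powf (F f) q = onef" using F_pow[OF f(1), of q] f(2) F_one by simp
  ultimately show ?thesis unfolding val_ulm_iff using F_closed f(1) h(1) by blast
qed

lemma F_delta: "x \<in> lattice k \<Longrightarrow> g \<in> carrier G \<Longrightarrow> F (delta x g) = shift (A x) (F (delta 0 g))"
  using F_shift[of x "delta 0 g"] by (simp add: shift_delta)

end

text \<open>These assumptions record the output of \<open>ulm_character\<close>; they say that
  \<open>\<tau>\<close> embeds \<open>P\<close> modulo \<open>Q\<close> into the \<open>q\<close>-th
  roots of unity, with \<open>s\<close> a generator.\<close>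

locale lamps_char = lamps +
  fixes \<tau> :: "'a \<Rightarrow> complex" and s :: 'a and q R :: nat
  assumes \<tau>_mult: "g \<in> carrier G \<Longrightarrow> h \<in> carrier G \<Longrightarrow> \<tau> (g \<otimes> h) = \<tau> g * \<tau> h"
    and \<tau>_nz: "\<tau> g \<noteq> 0"
    and ulm_Suc: "g \<in> ulm_set G q (R - 1) \<Longrightarrow> \<tau> g = 1 \<Longrightarrow> g \<in> ulm_set G q R"
    and \<tau>_ulm: "g \<in> ulm_set G q R \<Longrightarrow> \<tau> g = 1"
    and s_ulm: "s \<in> ulm_set G q (R - 1)"
    and \<tau>_s: "\<tau> s = cis (2 * pi / q)"
    and prime_q: "Factorial_Ring.prime q"
begin

abbreviation "P \<equiv> ulm_set G q (R - 1)"
abbreviation "Q \<equiv> ulm_set G q R"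

text \<open>The discrete logarithm of \<open>\<tau> g\<close> to the base \<open>\<tau> s\<close>,
  meaningful for \<open>g\<close> in \<open>P\<close>; it identifies the Ulm factor with the
  integers modulo \<open>q\<close>.\<close>

definition expo :: "'a \<Rightarrow> nat" where
  "expo g = (SOME a. a < q \<and> \<tau> g = \<tau> s ^ a)"

lemma q_pos: "q > 0"
  using prime_q prime_gt_0_nat by blast

lemma sG: "s \<in> carrier G"
  using s_ulm by (rule ulm_setD)

lemma \<tau>_one: "\<tau> \<one> = 1"
  using \<tau>_mult[of \<one> \<one>] \<tau>_nz[of \<one>] by simp

lemma \<tau>_pow: "g \<in> carrier G \<Longrightarrow> \<tau> (g [^] (m::nat)) = \<tau> g ^ m"
  by (induction m) (simp_all add: \<tau>_one \<tau>_mult)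

lemma \<tau>_P_root: "g \<in> P \<Longrightarrow> \<tau> g ^ q = 1"
  using \<tau>_pow[of g q] by (simp add: ulm_set_def \<tau>_one)

lemma s_pow: "\<tau> s ^ a = cis (2 * pi * real a / real q)"
  by (simp add: \<tau>_s DeMoivre mult_ac)

lemma s_pow_eq_1:
  "\<tau> s ^ a = 1 \<longleftrightarrow> q dvd a"
proof -
  have inj: "inj_on (\<lambda>k. cis (2 * pi * real k / real q)) {..<q}"
    using bij_betw_roots_unity[OF q_pos] by (simp add: bij_betw_def)
  have "\<tau> s ^ a = \<tau> s ^ (q * (a div q) + a mod q)" by simp
  also have "\<dots> = \<tau> s ^ (a mod q)"
    using \<tau>_P_root[OF s_ulm] by (simp only: power_add power_mult) simp
  finally have "\<tau> s ^ a = 1 \<longleftrightarrow> cis (2 * pi * real (a mod q) / real q) = cis (2 * pi * real 0 / real q)"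
    by (simp add: s_pow)
  also have "\<dots> \<longleftrightarrow> a mod q = 0"
    using inj q_pos by (subst inj_on_eq_iff[OF inj]) auto
  finally show ?thesis by (simp add: mod_eq_0_iff_dvd)
qed

lemma s_nontrivial: "\<tau> s \<noteq> 1"
  using s_pow_eq_1[of 1] prime_q by auto

lemma expo:
  assumes "g \<in> P"
  shows "expo g < q" "\<tau> g = \<tau> s ^ expo g"
proof -
  have "\<tau> g \<in> {z. z ^ q = 1}" using \<tau>_P_root assms by simp
  also have "\<dots> = (\<lambda>k. cis (2 * pi * real k / real q)) ` {..<q}"
    using bij_betw_roots_unity[OF q_pos] by (simp add: bij_betw_def)
  finally have "\<exists>a. a < q \<and> \<tau> g = \<tau> s ^ a" by (auto simp: s_pow)
  then have "expo g < q \<and> \<tau> g = \<tau> s ^ expo g" unfolding expo_def by (rule someI_ex)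
  then show "expo g < q" "\<tau> g = \<tau> s ^ expo g" by auto
qed

lemma expo_0_iff: "g \<in> P \<Longrightarrow> \<tau> g = 1 \<longleftrightarrow> expo g = 0"
  using expo[of g] s_pow_eq_1[of "expo g"] by (auto dest: dvd_imp_le)

text \<open>Modulo \<open>Q\<close> the group \<open>P\<close> is generated by \<open>s\<close>:
  after removal of the power of \<open>s\<close> with the same character value,
  \<open>ulm_Suc\<close> applies. The exponent \<open>q - expo g\<close> stands for
  \<open>- expo g\<close>.\<close>

lemma P_decomp:
  assumes "g \<in> P"
  obtains h where "h \<in> Q" "g = s [^] expo g \<otimes> h"
proof
  have gG: "g \<in> carrier G" using assms by (rule ulm_setD)
  define h where "h = s [^] (q - expo g) \<otimes> g"
  have "h \<in> P" unfolding h_def using assms s_ulm by (intro ulm_mult ulm_pow)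
  have e: "q - expo g + expo g = q" using expo(1)[OF assms] by simp
  have "\<tau> h = \<tau> s ^ (q - expo g) * \<tau> s ^ expo g"
    using gG sG expo(2)[OF assms] by (simp add: h_def \<tau>_mult \<tau>_pow)
  also have "\<dots> = 1" using \<tau>_P_root[OF s_ulm] by (simp only: e flip: power_add)
  finally have "\<tau> h = 1" .
  then show "s [^] (q - expo g) \<otimes> g \<in> Q" using ulm_Suc[OF \<open>h \<in> P\<close>] by (simp add: h_def)
  have "s [^] expo g \<otimes> s [^] (q - expo g) = \<one>"
    using sG e s_ulm by (simp add: G.nat_pow_mult ulm_set_def)
  then show "g = s [^] expo g \<otimes> (s [^] (q - expo g) \<otimes> g)"
    using sG gG by (simp flip: G.m_assoc)
qed

end

section \<open>The action on the Ulm factor as a twisted convolution\<close>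

locale lamps_char_map = lamps_char + lamps_map
begin

text \<open>The image of the generator of the Ulm factor over the group ring; the exponents of its
  entries are the coefficients of the group ring element describing \<open>F\<close>.\<close>

definition w :: "(nat \<Rightarrow> int) \<Rightarrow> 'a" where
  "w = F (delta 0 s)"

lemma w_P: "w z \<in> P"
  using F_val[OF delta_val[OF lattice_zero s_ulm]] by (simp add: w_def val_def)

lemma w_Sig: "w \<in> Sig"
  using sG by (simp add: w_def)

lemma F_delta_P:
  assumes g: "g \<in> P"
  shows "\<tau> (F (delta 0 g) y) = \<tau> (w y) ^ expo g"
proof -
  obtain h where h: "h \<in> Q" "g = s [^] expo g \<otimes> h" using P_decomp[OF g] .
  have hG: "h \<in> carrier G" using h(1) by (rule ulm_setD)
  have "powf (delta 0 s) (expo g) \<odot> delta 0 h = delta 0 (s [^] expo g \<otimes> h)"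
    by (rule ext) (simp add: powf_def mulf_def delta_def)
  then have "delta 0 g = powf (delta 0 s) (expo g) \<odot> delta 0 h" by (simp flip: h(2))
  then have "F (delta 0 g) = powf w (expo g) \<odot> F (delta 0 h)"
    using sG hG by (simp add: F_mult F_pow w_def)
  then have "F (delta 0 g) y = w y [^] expo g \<otimes> F (delta 0 h) y"
    by (simp add: mulf_def powf_def)
  moreover have "F (delta 0 h) y \<in> Q"
    using F_val[OF delta_val[OF lattice_zero h(1)]] by (simp add: val_def)
  ultimately show ?thesis
    using w_P[of y] by (simp add: \<tau>_mult \<tau>_pow \<tau>_ulm ulm_setD)
qed

text \<open>On the Ulm factor \<open>F\<close> is convolution with \<open>w\<close>, twisted by
  \<open>A\<close>. Products of roots of unity stand for sums modulo \<open>q\<close>.\<close>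

lemma F_convolution:
  assumes f: "f \<in> val P" and S: "finite S" "{z. f z \<noteq> \<one>} \<subseteq> S"
  shows "\<tau> (F f y) = (\<Prod>x\<in>S. \<tau> (w (y - A x)) ^ expo (f x))"
proof -
  have fS: "f \<in> Sig" and fP: "f x \<in> P" for x using f by (auto simp: val_def)
  \<comment> \<open>For fixed \<open>y\<close> this is a character of \<open>Sig\<close>, so point
    masses suffice.\<close>
  have "character (\<lambda>f. \<tau> (F f y))"
    unfolding character_def
  proof (intro conjI ballI)
    fix f g assume "f \<in> Sig" "g \<in> Sig"
    then have "F (f \<odot> g) y = F f y \<otimes> F g y" "F f y \<in> carrier G" "F g y \<in> carrier G"
      using Sig_carrier[OF F_closed] by (simp_all add: F_mult) (simp add: mulf_def)
    then show "\<tau> (F (f \<odot> g) y) = \<tau> (F f y) * \<tau> (F g y)" by (simp add: \<tau>_mult)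
  qed (rule \<tau>_nz)
  from character_decomp[OF this fS S]
  have "\<tau> (F f y) = (\<Prod>x\<in>S. \<tau> (F (delta x (f x)) y))" .
  also have "\<dots> = (\<Prod>x\<in>S. \<tau> (w (y - A x)) ^ expo (f x))"
  proof (rule prod.cong)
    fix x
    show "\<tau> (F (delta x (f x)) y) = \<tau> (w (y - A x)) ^ expo (f x)"
    proof (cases "x \<in> lattice k")
      case True
      then have "F (delta x (f x)) y = F (delta 0 (f x)) (y - A x)"
        using F_delta[OF True ulm_setD[OF fP]] by (simp add: shift_def)
      then show ?thesis using F_delta_P[OF fP] by simp
    next
      case False
      then have fx: "f x = \<one>" using Sig_out[OF fS] by blast
      have "expo \<one> = 0" using expo_0_iff[OF ulm_one] \<tau>_one by simp
      moreover have "\<tau> (F onef y) = 1" unfolding F_one unfolding onef_def by (rule \<tau>_one)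
      ultimately show ?thesis by (simp add: fx)
    qed
  qed simp
  finally show ?thesis .
qed

lemma w_support:
  shows "finite {z. \<tau> (w z) \<noteq> 1}" "{z. \<tau> (w z) \<noteq> 1} \<subseteq> lattice k"
proof -
  have "{z. \<tau> (w z) \<noteq> 1} \<subseteq> {z. w z \<noteq> \<one>}" using \<tau>_one by auto
  then show "finite {z. \<tau> (w z) \<noteq> 1}" using Sig_finite[OF w_Sig] finite_subset by blast
  show "{z. \<tau> (w z) \<noteq> 1} \<subseteq> lattice k" using Sig_out[OF w_Sig] \<tau>_one by fastforce
qed

end

locale lamps_char_auto = lamps_char + lattice_auto + F: lamps_char_map G k \<tau> s q R A F
  + F': lamps_char_map G k \<tau> s q R B F' for F F' +
  assumes F'_F: "f \<in> Sig \<Longrightarrow> F' (F f) = f"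
begin

text \<open>Since \<open>F'\<close> inverts \<open>F\<close>, their group ring elements multiply to
  1 after the twist, so the one of \<open>F\<close> has a single nonzero coefficient. Its position
  is \<open>m\<close> and its value is \<open>c\<close>.\<close>

lemma monomial:
  obtains m c where "m \<in> lattice k" "0 < c" "c < q"
    "\<And>f x. f \<in> val P \<Longrightarrow> x \<in> lattice k \<Longrightarrow> \<tau> (F f (A x + m)) = \<tau> (f x) ^ c"
proof -
  define T0 where "T0 = {z. \<tau> (F.w z) \<noteq> 1}"
  \<comment> \<open>\<open>F'\<close> moves position \<open>x\<close> by \<open>B x\<close>, so the
    supports that add up in \<open>F' F\<close> are the image of \<open>T0\<close> under
    \<open>B\<close> and \<open>T'\<close>.\<close>
  define T where "T = B ` T0"
  define T' where "T' = {z. \<tau> (F'.w z) \<noteq> 1}"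
  have T0: "finite T0" "T0 \<subseteq> lattice k" using F.w_support by (auto simp: T0_def)
  have T': "finite T'" using F'.w_support by (simp add: T'_def)
  have wval: "F.w \<in> val P" using F.w_P F.w_Sig by (simp add: val_def)
  define S where "S = {z. F.w z \<noteq> \<one>}"
  have S: "finite S" using Sig_finite[OF F.w_Sig] by (simp add: S_def)
  have ds: "\<tau> (delta 0 s y) = (\<Prod>x\<in>S. \<tau> (F'.w (y - B x)) ^ expo (F.w x))" for y
  proof -
    have "F' F.w = delta 0 s" using F'_F[of "delta 0 s"] sG by (simp add: F.w_def)
    then show ?thesis using F'.F_convolution[OF wval S, of y] by (simp add: S_def)
  qed
  have s0: "\<tau> (delta 0 s 0) \<noteq> 1" using s_nontrivial by (simp add: delta_def)
  have "T0 \<noteq> {}"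
  proof
    assume "T0 = {}"
    then have "expo (F.w x) = 0" for x using expo_0_iff[OF F.w_P] by (auto simp: T0_def)
    then show False using ds[of 0] s0 by simp
  qed
  then have Tne: "T \<noteq> {}" by (simp add: T_def)
  have "T' \<noteq> {}"
  proof
    assume "T' = {}"
    then have "\<tau> (F'.w x) = 1" for x by (auto simp: T'_def)
    then show False using ds[of 0] s0 by simp
  qed
  \<comment> \<open>At a uniquely represented position only one factor of the convolution survives.
    It is nontrivial, whereas \<open>delta 0 s\<close> is trivial away from 0.\<close>
  moreover have "t + t' = 0" if t: "t \<in> T" "t' \<in> T'"
    and uniq: "\<And>u u'. u \<in> T \<Longrightarrow> u' \<in> T' \<Longrightarrow> u + u' = t + t' \<Longrightarrow> u = t \<and> u' = t'" for t t'
  proof -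
    obtain z where z: "z \<in> T0" "t = B z" using t by (auto simp: T_def)
    have zL: "z \<in> lattice k" using z T0 by blast
    have zS: "z \<in> S" using z(1) \<tau>_one by (auto simp: S_def T0_def)
    have other: "\<tau> (F'.w (t + t' - B x)) ^ expo (F.w x) = 1" if x: "x \<in> S - {z}" for x
    proof (cases "x \<in> T0")
      case True
      have xL: "x \<in> lattice k" using True T0 by blast
      have "t + t' - B x \<notin> T'"
      proof
        assume 1: "t + t' - B x \<in> T'"
        have 2: "B x \<in> T" using True by (simp add: T_def)
        have "B x + (t + t' - B x) = t + t'" by (rule trans[OF add.commute diff_add_cancel])
        then have "B x = t" using uniq[OF 2 1] by blast
        then have "A (B x) = A (B z)" by (simp only: z(2))
        then show False using xL zL x by simp
      qed
      then show ?thesis by (simp add: T'_def)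
    next
      case False
      then have "expo (F.w x) = 0" using expo_0_iff[OF F.w_P] by (auto simp: T0_def)
      then show ?thesis by simp
    qed
    have zt: "t + t' - B z = t'" using z(2) by simp
    have "\<tau> (delta 0 s (t + t')) = \<tau> (F'.w (t + t' - B z)) ^ expo (F.w z)
        * (\<Prod>x\<in>S - {z}. \<tau> (F'.w (t + t' - B x)) ^ expo (F.w x))"
      unfolding ds using S zS by (rule prod.remove)
    also have "(\<Prod>x\<in>S - {z}. \<tau> (F'.w (t + t' - B x)) ^ expo (F.w x)) = 1"
      using other by (rule prod.neutral[OF ballI])
    finally have eq: "\<tau> (delta 0 s (t + t')) = \<tau> s ^ (expo (F'.w t') * expo (F.w z))"
      by (simp only: zt power_mult mult_1_right flip: expo(2)[OF F'.w_P, of t'])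
    \<comment> \<open>Since \<open>q\<close> is prime, the product of two nonzero coefficients is
      nonzero modulo \<open>q\<close>.\<close>
    have "\<not> q dvd expo (F'.w t')" "\<not> q dvd expo (F.w z)"
      unfolding s_pow_eq_1[symmetric] expo(2)[OF F'.w_P, symmetric] expo(2)[OF F.w_P, symmetric]
      using t(2) z(1) by (simp_all add: T'_def T0_def)
    then have "\<tau> (delta 0 s (t + t')) \<noteq> 1"
      unfolding eq s_pow_eq_1 using prime_q by (simp add: prime_dvd_mult_iff)
    then show ?thesis using \<tau>_one by (auto simp: delta_def split: if_splits)
  qed
  ultimately obtain m' where m': "T = {m'}"
    using unique_sum_singleton[of T T'] T0 T' Tne by (auto simp: T_def)
  define m where "m = A m'"
  have T0m: "T0 = {m}"
  proof -
    have "z = m" if "z \<in> T0" for z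
    proof -
      have "B z = m'" using that m' by (auto simp: T_def)
      then show ?thesis using that T0 by (auto simp: m_def)
    qed
    then show ?thesis using \<open>T0 \<noteq> {}\<close> by blast
  qed
  show thesis
  proof (rule that[of m "expo (F.w m)"])
    show "m \<in> lattice k" using T0m T0 by simp
    have "m \<in> T0" using T0m by simp
    then show "0 < expo (F.w m)" using expo_0_iff[OF F.w_P, of m] by (simp add: T0_def)
    show "expo (F.w m) < q" using expo(1)[OF F.w_P] .
    fix f x assume f: "f \<in> val P" and x: "x \<in> lattice k"
    have fS: "f \<in> Sig" and fP: "f u \<in> P" for u using f by (auto simp: val_def)
    define U where "U = insert x {z. f z \<noteq> \<one>}"
    have U: "finite U" "{z. f z \<noteq> \<one>} \<subseteq> U" "x \<in> U" using Sig_finite[OF fS] by (auto simp: U_def)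
    have UL: "u \<in> lattice k" if "u \<in> U" for u using that x Sig_out[OF fS] by (auto simp: U_def)
    \<comment> \<open>By injectivity of \<open>A\<close>, only the entry of \<open>f\<close> at
      \<open>x\<close> is moved to position \<open>A x + m\<close>.\<close>
    have other: "\<tau> (F.w (A x + m - A u)) ^ expo (f u) = 1" if u: "u \<in> U - {x}" for u
    proof -
      have "A x + m - A u \<notin> T0"
      proof
        assume "A x + m - A u \<in> T0"
        then have "A x = A u" using T0m by (simp add: algebra_simps)
        then have "B (A x) = B (A u)" by simp
        then show False using x UL[of u] u by simp
      qed
      then show ?thesis by (simp add: T0_def)
    qed
    have "\<tau> (F f (A x + m)) = \<tau> (F.w (A x + m - A x)) ^ expo (f x)
        * (\<Prod>u\<in>U - {x}. \<tau> (F.w (A x + m - A u)) ^ expo (f u))"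
      unfolding F.F_convolution[OF f U(1,2)] using U(1,3) by (rule prod.remove)
    also have "(\<Prod>u\<in>U - {x}. \<tau> (F.w (A x + m - A u)) ^ expo (f u)) = 1"
      using other by (rule prod.neutral[OF ballI])
    also have "A x + m - A x = m" by simp
    finally have "\<tau> (F f (A x + m)) = (\<tau> s ^ expo (F.w m)) ^ expo (f x)"
      using expo(2)[OF F.w_P, of m] by simp
    also have "\<dots> = \<tau> (f x) ^ expo (F.w m)"
      using expo(2)[OF fP, of x] by (simp add: mult.commute flip: power_mult)
    finally show "\<tau> (F f (A x + m)) = \<tau> (f x) ^ expo (F.w m)" .
  qed
qed

end

section \<open>Counting invariant characters\<close>

context lamps
begin

text \<open>The value 1 outside \<open>Sig\<close> makes equal characters equal as functions, so
  that they can be counted.\<close>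

definition characters :: "(((nat \<Rightarrow> int) \<Rightarrow> 'a) \<Rightarrow> complex) set" where
  "characters = {\<chi>. character \<chi> \<and> (\<forall>f. f \<notin> Sig \<longrightarrow> \<chi> f = 1)}"

definition periodic_characters :: "nat \<Rightarrow> (((nat \<Rightarrow> int) \<Rightarrow> 'a) \<Rightarrow> complex) set" where
  "periodic_characters N = {\<chi> \<in> characters. \<forall>z\<in>lattice k. \<forall>f\<in>Sig. \<chi> (shift (smul (int N) z) f) = \<chi> f}"

lemma charactersD: "\<chi> \<in> characters \<Longrightarrow> character \<chi>" "\<chi> \<in> characters \<Longrightarrow> f \<notin> Sig \<Longrightarrow> \<chi> f = 1"
  by (simp_all add: characters_def)

lemma characters_nz: "\<chi> \<in> characters \<Longrightarrow> \<chi> f \<noteq> 0"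
  using charactersD[of \<chi>] character_nz[of \<chi> f] by (cases "f \<in> Sig") auto

lemma characters_mult: "\<chi> \<in> characters \<Longrightarrow> \<eta> \<in> characters \<Longrightarrow> (\<lambda>f. \<chi> f * \<eta> f) \<in> characters"
  by (simp add: characters_def character_def)

lemma characters_divide: "\<chi> \<in> characters \<Longrightarrow> \<eta> \<in> characters \<Longrightarrow> (\<lambda>f. \<chi> f / \<eta> f) \<in> characters"
  by (simp add: characters_def character_def)

lemma periodic_mult: "\<chi> \<in> periodic_characters N \<Longrightarrow> \<eta> \<in> periodic_characters N \<Longrightarrow> (\<lambda>f. \<chi> f * \<eta> f) \<in> periodic_characters N"
  using characters_mult by (simp add: periodic_characters_def)

lemma characters_eqI:
  assumes "\<chi> \<in> characters" "\<eta> \<in> characters" "\<And>x g. x \<in> lattice k \<Longrightarrow> g \<in> carrier G \<Longrightarrow> \<chi> (delta x g) = \<eta> (delta x g)"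
  shows "\<chi> = \<eta>"
proof
  fix f show "\<chi> f = \<eta> f"
  proof (cases "f \<in> Sig")
    case True
    then show ?thesis
    proof (induction f rule: Sig_induct)
      case one
      show ?case using assms(1,2) by (simp add: character_one charactersD)
    next
      case (mult f x g)
      then show ?case using assms by (simp add: character_mult charactersD)
    qed
  next
    case False
    then show ?thesis using assms(1,2) by (simp add: charactersD)
  qed
qed

lemma character_root:
  assumes "character \<chi>" "f \<in> Sig"
  shows "\<chi> f ^ Coset.order G = 1"
proof -
  have "powf f (Coset.order G) = onef"
    using Sig_carrier[OF assms(2)] by (simp add: powf_def onef_def G.pow_order_eq_1)
  then show ?thesis using character_pow[OF assms, of "Coset.order G"] character_one[OF assms(1)] by simp
qed

lemma characters_root: "\<chi> \<in> characters \<Longrightarrow> \<chi> f ^ Coset.order G = 1"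
  using character_root[of \<chi> f] charactersD[of \<chi>] by (cases "f \<in> Sig") auto

lemma order_pos: "Coset.order G > 0"
  using fin G.order_gt_0_iff_finite by simp

text \<open>Periodicity leaves only the values on point masses at positions in
  \<open>box k N\<close>, and these are roots of unity whose order divides that of
  \<open>G\<close>.\<close>

lemma finite_periodic_characters:
  assumes "N > 0"
  shows "finite (periodic_characters N)"
proof -
  define D where "D = box k N \<times> carrier G"
  define \<Phi> where "\<Phi> \<chi> = restrict (\<lambda>(x, g). \<chi> (delta x g)) D" for \<chi> :: "((nat \<Rightarrow> int) \<Rightarrow> 'a) \<Rightarrow> complex"
  have "finite D" using finite_box fin by (simp add: D_def)
  then have "finite (D \<rightarrow>\<^sub>E {z :: complex. z ^ Coset.order G = 1})"
    using order_pos by (intro finite_PiE) (auto simp: finite_roots_unity Suc_le_eq)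
  moreover have "\<Phi> ` periodic_characters N \<subseteq> D \<rightarrow>\<^sub>E {z. z ^ Coset.order G = 1}"
  proof
    fix h assume "h \<in> \<Phi> ` periodic_characters N"
    then obtain \<chi> where "\<chi> \<in> characters" "h = \<Phi> \<chi>" by (auto simp: periodic_characters_def)
    then show "h \<in> D \<rightarrow>\<^sub>E {z. z ^ Coset.order G = 1}"
      by (simp add: \<Phi>_def characters_root split: prod.split)
  qed
  moreover have "inj_on \<Phi> (periodic_characters N)"
  proof (rule inj_onI)
    fix \<chi> \<eta> assume \<chi>: "\<chi> \<in> periodic_characters N" and \<eta>: "\<eta> \<in> periodic_characters N" and eq: "\<Phi> \<chi> = \<Phi> \<eta>"
    have red: "\<theta> (delta x g) = \<theta> (delta (\<lambda>i. x i mod int N) g)"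
      if "\<theta> \<in> periodic_characters N" "x \<in> lattice k" "g \<in> carrier G" for \<theta> x g
    proof -
      define y where "y = (\<lambda>i. x i mod int N)"
      have y: "y \<in> lattice k" using mod_in_box[OF that(2) assms] by (simp add: y_def box_def)
      define z where "z = (\<lambda>i. x i div int N)"
      have z: "z \<in> lattice k" using that(2) by (simp add: z_def lattice_def)
      have "smul (int N) z + y = x" by (rule ext) (simp add: pointwise z_def y_def)
      then have "delta x g = shift (smul (int N) z) (delta y g)" by (simp add: shift_delta)
      then show ?thesis using that y z by (simp add: periodic_characters_def flip: y_def)
    qed
    show "\<chi> = \<eta>"
    proof (rule characters_eqI)
      fix x g assume x: "x \<in> lattice k" and g: "g \<in> carrier G"
      define y where "y = (\<lambda>i. x i mod int N)"
      have "(y, g) \<in> D" using mod_in_box[OF x assms] g by (simp add: D_def y_def)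
      then have "\<chi> (delta y g) = \<eta> (delta y g)" using fun_cong[OF eq, of "(y, g)"] by (simp add: \<Phi>_def)
      then show "\<chi> (delta x g) = \<eta> (delta x g)"
        using red[OF \<chi> x g] red[OF \<eta> x g] by (simp add: y_def)
    qed (use \<chi> \<eta> in \<open>simp_all add: periodic_characters_def\<close>)
  qed
  ultimately show ?thesis using finite_subset finite_imageD by blast
qed

text \<open>A character constant on the fibres of \<open>cl\<close> is determined by one root of
  unity for each element of \<open>C\<close>.\<close>

lemma card_characters_le:
  assumes "finite C" and cl: "\<And>f. f \<in> Sig \<Longrightarrow> cl f \<in> C"
    and E: "E \<subseteq> characters" "\<And>\<chi> f g. \<chi> \<in> E \<Longrightarrow> f \<in> Sig \<Longrightarrow> g \<in> Sig \<Longrightarrow> cl f = cl g \<Longrightarrow> \<chi> f = \<chi> g"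
  shows "card E \<le> Coset.order G ^ card C"
proof -
  define rep where "rep c = (SOME f. f \<in> Sig \<and> cl f = c)" for c
  have rep: "rep (cl f) \<in> Sig \<and> cl (rep (cl f)) = cl f" if "f \<in> Sig" for f
    unfolding rep_def using that by (intro someI[of "\<lambda>g. g \<in> Sig \<and> cl g = cl f" f]) simp
  define \<Phi> where "\<Phi> \<chi> = restrict (\<lambda>c. \<chi> (rep c)) C" for \<chi> :: "((nat \<Rightarrow> int) \<Rightarrow> 'a) \<Rightarrow> complex"
  have roots: "finite {z :: complex. z ^ Coset.order G = 1}" "card {z :: complex. z ^ Coset.order G = 1} = Coset.order G"
    using order_pos by (simp_all add: finite_roots_unity Suc_le_eq card_roots_unity_eq)
  have "\<Phi> ` E \<subseteq> C \<rightarrow>\<^sub>E {z. z ^ Coset.order G = 1}"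
  proof
    fix h assume "h \<in> \<Phi> ` E"
    then obtain \<chi> where \<chi>: "\<chi> \<in> E" "h = \<Phi> \<chi>" by blast
    then show "h \<in> C \<rightarrow>\<^sub>E {z. z ^ Coset.order G = 1}"
      using E(1) characters_root by (auto simp: \<Phi>_def)
  qed
  moreover have "inj_on \<Phi> E"
  proof (rule inj_onI)
    fix \<chi> \<eta> assume \<chi>: "\<chi> \<in> E" and \<eta>: "\<eta> \<in> E" and eq: "\<Phi> \<chi> = \<Phi> \<eta>"
    show "\<chi> = \<eta>"
    proof
      fix f show "\<chi> f = \<eta> f"
      proof (cases "f \<in> Sig")
        case True
        have "\<chi> (rep (cl f)) = \<eta> (rep (cl f))"
          using fun_cong[OF eq, of "cl f"] cl[OF True] by (simp add: \<Phi>_def)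
        moreover have "\<chi> f = \<chi> (rep (cl f))" using rep[OF True] True by (intro E(2)[OF \<chi>]) auto
        moreover have "\<eta> f = \<eta> (rep (cl f))" using rep[OF True] True by (intro E(2)[OF \<eta>]) auto
        ultimately show ?thesis by simp
      next
        case False
        then show ?thesis using E(1) \<chi> \<eta> charactersD by (metis subsetD)
      qed
    qed
  qed
  ultimately have "card E \<le> card (C \<rightarrow>\<^sub>E {z :: complex. z ^ Coset.order G = 1})"
    using assms(1) roots by (intro card_inj_on_le) (auto intro: finite_PiE)
  then show ?thesis using assms(1) roots by (simp add: card_PiE)
qed

end

section \<open>Weight characters and their correction to invariant ones\<close>

context lamps_char
begin

text \<open>Any weight \<open>v\<close> is admissible since only finitely many factors differ from
  1; \<open>S\<close> is left free to allow reindexing.\<close>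

lemma weight_character:
  fixes v :: "(nat \<Rightarrow> int) \<Rightarrow> nat"
  obtains L where "L \<in> characters"
    "\<And>f S. f \<in> Sig \<Longrightarrow> finite S \<Longrightarrow> {z. f z \<noteq> \<one>} \<subseteq> S \<Longrightarrow> L f = (\<Prod>x\<in>S. \<tau> (f x) ^ v x)"
proof -
  define L where "L f = (if f \<in> Sig then \<Prod>x\<in>{z. f z \<noteq> \<one>}. \<tau> (f x) ^ v x else 1)" for f
  have L: "L f = (\<Prod>x\<in>S. \<tau> (f x) ^ v x)" if "f \<in> Sig" "finite S" "{z. f z \<noteq> \<one>} \<subseteq> S" for f S
  proof -
    have "L f = (\<Prod>x\<in>{z. f z \<noteq> \<one>}. \<tau> (f x) ^ v x)" using that by (simp add: L_def)
    also have "\<dots> = (\<Prod>x\<in>S. \<tau> (f x) ^ v x)"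
      using that \<tau>_one by (intro prod.mono_neutral_left) auto
    finally show ?thesis .
  qed
  have "character L"
    unfolding character_def
  proof (intro conjI ballI)
    fix f g assume fg: "f \<in> Sig" "g \<in> Sig"
    define S where "S = {z. f z \<noteq> \<one>} \<union> {z. g z \<noteq> \<one>}"
    have S: "finite S" using fg Sig_finite by (simp add: S_def)
    have "{z. (f \<odot> g) z \<noteq> \<one>} \<subseteq> S" by (auto simp: S_def mulf_def)
    then have "L (f \<odot> g) = (\<Prod>x\<in>S. \<tau> ((f \<odot> g) x) ^ v x)" using fg S by (intro L) auto
    also have "\<dots> = (\<Prod>x\<in>S. \<tau> (f x) ^ v x * \<tau> (g x) ^ v x)"
      using Sig_carrier[OF fg(1)] Sig_carrier[OF fg(2)]
      by (intro prod.cong) (simp_all add: mulf_def \<tau>_mult power_mult_distrib)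
    also have "\<dots> = L f * L g"
      using fg S by (simp add: prod.distrib L[of f S] L[of g S] S_def)
    finally show "L (f \<odot> g) = L f * L g" .
  next
    fix f assume "f \<in> Sig"
    then show "L f \<noteq> 0" using Sig_finite[of f] \<tau>_nz by (simp add: L_def)
  qed
  then have "L \<in> characters" by (simp add: characters_def L_def)
  then show thesis using that L by blast
qed

text \<open>
  The weight characters are \<open>\<Psi>\<close>-invariant only up to characters trivial on \<open>val P\<close>, and the
  pigeonhole principle for \<open>\<chi> \<mapsto> \<chi> \<circ> \<Psi> / \<chi>\<close> turns them into equally many invariant characters.
\<close>

lemma many_invariant_characters:
  assumes "lattice_auto k A B" "lamps_map G k A \<Psi>"
    and \<Psi>: "\<And>f x. f \<in> val P \<Longrightarrow> x \<in> lattice k \<Longrightarrow> \<tau> (\<Psi> f (A x)) = \<tau> (f x) ^ c"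
    and M: "M > 0" and t: "\<And>j. t j \<in> lattice k"
    and per: "\<And>x y j m. x \<in> lattice k \<Longrightarrow> y \<in> lattice k \<Longrightarrow> j < m \<Longrightarrow> cgr (int M ^ m) x y \<Longrightarrow> v j x = v j y"
    and eqv: "\<And>x j. x \<in> lattice k \<Longrightarrow> [c * v j (A x) = v j x] (mod q)"
    and pos: "\<And>j. 0 < v j (t j)" "\<And>j. v j (t j) < q" and vz: "\<And>i j. i < j \<Longrightarrow> v i (t j) = 0"
  shows "\<exists>E. finite E \<and> m \<le> card E \<and> E \<subseteq> {\<chi> \<in> characters. \<forall>f\<in>Sig. \<chi> (\<Psi> f) = \<chi> f}"
proof -
  interpret lattice_auto k A B by fact
  interpret \<Psi>: lamps_map G k A \<Psi> by fact
  \<comment> \<open>A common period of the first \<open>m\<close> weights.\<close>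
  define N where "N = M ^ m"
  have N: "N > 0" using M by (simp add: N_def)
  define K where "K = {\<chi> \<in> periodic_characters N. \<forall>f\<in>val P. \<chi> f = 1}"
  have "\<exists>L. L \<in> characters \<and> (\<forall>f S. f \<in> Sig \<longrightarrow> finite S \<longrightarrow> {z. f z \<noteq> \<one>} \<subseteq> S \<longrightarrow> L f = (\<Prod>x\<in>S. \<tau> (f x) ^ v j x))" for j
    by (rule weight_character[of "v j"]) blast
  then obtain L where L0: "\<forall>j. L j \<in> characters \<and> (\<forall>f S. f \<in> Sig \<longrightarrow> finite S \<longrightarrow> {z. f z \<noteq> \<one>} \<subseteq> S \<longrightarrow> L j f = (\<Prod>x\<in>S. \<tau> (f x) ^ v j x))"
    using choice[of "\<lambda>j L. L \<in> characters \<and> (\<forall>f S. f \<in> Sig \<longrightarrow> finite S \<longrightarrow> {z. f z \<noteq> \<one>} \<subseteq> S \<longrightarrow> L f = (\<Prod>x\<in>S. \<tau> (f x) ^ v j x))"]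
    by blast
  have Lc: "L j \<in> characters" for j using L0 by blast
  have L: "L j f = (\<Prod>x\<in>S. \<tau> (f x) ^ v j x)" if "f \<in> Sig" "finite S" "{z. f z \<noteq> \<one>} \<subseteq> S" for j f S
    using L0 that by blast
  have Lper: "L j \<in> periodic_characters N" if j: "j < m" for j
  proof -
    have "L j (shift (smul (int N) z) f) = L j f" if z: "z \<in> lattice k" and f: "f \<in> Sig" for z f
    proof -
      define S where "S = {y. f y \<noteq> \<one>}"
      have S: "finite S" "{y. f y \<noteq> \<one>} \<subseteq> S" using Sig_finite[OF f] by (auto simp: S_def)
      have SL: "y \<in> lattice k" if "y \<in> S" for y using that Sig_out[OF f] by (auto simp: S_def)
      define u where "u = smul (int N) z"
      have u: "u \<in> lattice k" using z by (simp add: u_def)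
      have "{y. shift u f y \<noteq> \<one>} \<subseteq> (\<lambda>y. y + u) ` S"
        by (auto simp: shift_def S_def intro!: image_eqI[of _ _ "_ - u"])
      then have "L j (shift u f) = (\<Prod>y\<in>(\<lambda>y. y + u) ` S. \<tau> (shift u f y) ^ v j y)"
        using S(1) f u by (intro L) auto
      also have "\<dots> = (\<Prod>y\<in>S. \<tau> (f y) ^ v j (y + u))"
        by (subst prod.reindex) (auto simp: inj_on_def shift_def)
      also have "\<dots> = (\<Prod>y\<in>S. \<tau> (f y) ^ v j y)"
      proof (rule prod.cong)
        fix y assume "y \<in> S"
        then have "v j (y + u) = v j y"
          using SL u j by (intro per[of _ _ j m]) (auto simp: u_def N_def intro: cgr_add_smul)
        then show "\<tau> (f y) ^ v j (y + u) = \<tau> (f y) ^ v j y" by simp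
      qed simp
      also have "\<dots> = L j f" using L[OF f S] by simp
      finally show ?thesis by (simp add: u_def)
    qed
    then show ?thesis using Lc by (simp add: periodic_characters_def)
  qed
  \<comment> \<open>Reindexing along \<open>A\<close> turns the exponent at \<open>x\<close> into
    \<open>c * v j (A x)\<close>, which matters only modulo \<open>q\<close> because
    \<open>\<tau>\<close> takes \<open>q\<close>-th roots of unity as values on
    \<open>P\<close>.\<close>
  have L\<Psi>: "L j (\<Psi> f) = L j f" if f: "f \<in> val P" for j f
  proof -
    have fS: "f \<in> Sig" and fP: "f x \<in> P" for x using f by (auto simp: val_def)
    define S where "S = {y. f y \<noteq> \<one>} \<union> B ` {y. \<Psi> f y \<noteq> \<one>}"
    have S: "finite S" "{y. f y \<noteq> \<one>} \<subseteq> S"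
      using Sig_finite[OF fS] Sig_finite[OF \<Psi>.F_closed[OF fS]] by (auto simp: S_def)
    have "{y. f y \<noteq> \<one>} \<subseteq> lattice k" "{y. \<Psi> f y \<noteq> \<one>} \<subseteq> lattice k"
      using Sig_out[OF fS] Sig_out[OF \<Psi>.F_closed[OF fS]] by blast+
    then have SL: "S \<subseteq> lattice k" and sub: "{y. \<Psi> f y \<noteq> \<one>} \<subseteq> A ` S"
      by (auto simp: S_def image_Un image_image subset_iff)
    have injA: "inj_on A S" using SL inv_left by (intro inj_on_inverseI[of _ B]) auto
    have "L j (\<Psi> f) = (\<Prod>y\<in>A ` S. \<tau> (\<Psi> f y) ^ v j y)" using S(1) sub fS by (intro L) auto
    also have "\<dots> = (\<Prod>x\<in>S. \<tau> (\<Psi> f (A x)) ^ v j (A x))" using injA by (simp add: prod.reindex)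
    also have "\<dots> = (\<Prod>x\<in>S. \<tau> (f x) ^ v j x)"
    proof (rule prod.cong)
      fix x assume "x \<in> S"
      then have xL: "x \<in> lattice k" using SL by blast
      have root: "\<tau> (f x) ^ a = \<tau> (f x) ^ (a mod q)" for a
      proof -
        have "\<tau> (f x) ^ a = \<tau> (f x) ^ (q * (a div q) + a mod q)" by simp
        also have "\<dots> = \<tau> (f x) ^ (a mod q)"
          using \<tau>_P_root[OF fP, of x] by (simp only: power_add power_mult) simp
        finally show ?thesis .
      qed
      have "\<tau> (\<Psi> f (A x)) ^ v j (A x) = \<tau> (f x) ^ (c * v j (A x))"
        by (simp only: \<Psi>[OF f xL] power_mult)
      also have "\<dots> = \<tau> (f x) ^ ((c * v j (A x)) mod q)" by (rule root)
      also have "(c * v j (A x)) mod q = v j x mod q" using eqv[OF xL] by (simp only: cong_def)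
      also have "\<tau> (f x) ^ (v j x mod q) = \<tau> (f x) ^ v j x" by (rule root[symmetric])
      finally show "\<tau> (\<Psi> f (A x)) ^ v j (A x) = \<tau> (f x) ^ v j x" .
    qed simp
    also have "\<dots> = L j f" using L[OF fS S] by simp
    finally show ?thesis .
  qed
  have Ldelta: "L j (delta x s) = \<tau> s ^ v j x" if "x \<in> lattice k" for j x
  proof -
    have "L j (delta x s) = (\<Prod>y\<in>{x}. \<tau> (delta x s y) ^ v j y)"
      by (rule L[OF delta_Sig[OF that sG]]) (auto simp: delta_def)
    then show ?thesis by (simp add: delta_def)
  qed
  \<comment> \<open>The defect of invariance; on \<open>E\<close> it takes values in
    \<open>K\<close>.\<close>
  define \<rho> where "\<rho> \<chi> = (\<lambda>f. if f \<in> Sig then \<chi> (\<Psi> f) / \<chi> f else 1)" for \<chi> :: "((nat \<Rightarrow> int) \<Rightarrow> 'a) \<Rightarrow> complex"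
  have \<rho>_per: "\<rho> \<chi> \<in> periodic_characters N" if \<chi>: "\<chi> \<in> periodic_characters N" for \<chi>
  proof -
    have \<chi>c: "\<chi> \<in> characters" using \<chi> by (simp add: periodic_characters_def)
    have "character (\<rho> \<chi>)"
      using charactersD(1)[OF \<chi>c] characters_nz[OF \<chi>c]
      by (simp add: character_def \<rho>_def \<Psi>.F_mult)
    moreover have "\<rho> \<chi> (shift (smul (int N) z) f) = \<rho> \<chi> f" if z: "z \<in> lattice k" and f: "f \<in> Sig" for z f
    proof -
      have "\<chi> (\<Psi> (shift (smul (int N) z) f)) = \<chi> (\<Psi> f)"
        using \<chi> z f by (simp add: \<Psi>.F_shift smul periodic_characters_def)
      moreover have "\<chi> (shift (smul (int N) z) f) = \<chi> f"
        using \<chi> z f by (simp add: periodic_characters_def)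
      ultimately show ?thesis using z f by (simp add: \<rho>_def)
    qed
    ultimately show ?thesis by (simp add: periodic_characters_def characters_def \<rho>_def)
  qed
  define E where "E = (\<lambda>(j, \<kappa>) f. L j f * \<kappa> f) ` ({..<m} \<times> K)"
  have finK: "finite K" using finite_periodic_characters[OF N] by (simp add: K_def)
  have finE: "finite E" using finK by (simp add: E_def)
  have Kc: "\<kappa> \<in> characters" "\<kappa> \<in> periodic_characters N" if "\<kappa> \<in> K" for \<kappa>
    using that by (auto simp: K_def periodic_characters_def)
  have "(\<lambda>_. 1) \<in> K"
    by (simp add: K_def periodic_characters_def characters_def character_def)
  then have Kne: "K \<noteq> {}" by blast
  have ts: "delta (t j) s \<in> val P" for j using delta_val[OF t s_ulm] .
  have inj: "inj_on (\<lambda>(j, \<kappa>) f. L j f * \<kappa> f) ({..<m} \<times> K)"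
  proof (rule inj_onI, clarify)
    fix j \<kappa> i \<eta> assume \<kappa>: "\<kappa> \<in> K" and \<eta>: "\<eta> \<in> K"
      and eq: "(\<lambda>f. L j f * \<kappa> f) = (\<lambda>f. L i f * \<eta> f)"
    \<comment> \<open>Elements of \<open>K\<close> are trivial on the test element
      \<open>delta (t j) s\<close>, which the \<open>j\<close>-th weight detects and the earlier
      ones do not.\<close>
    have le: "\<not> i < j" if "(\<lambda>f. L j f * \<kappa> f) = (\<lambda>f. L i f * \<eta> f)" "\<kappa> \<in> K" "\<eta> \<in> K" for i j \<kappa> \<eta>
    proof
      assume "i < j"
      have "L j (delta (t j) s) * \<kappa> (delta (t j) s) = L i (delta (t j) s) * \<eta> (delta (t j) s)"
        using fun_cong[OF that(1)] .
      moreover have "\<kappa> (delta (t j) s) = 1" "\<eta> (delta (t j) s) = 1"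
        using that(2,3) ts by (auto simp: K_def)
      ultimately have "\<tau> s ^ v j (t j) = 1"
        using vz[OF \<open>i < j\<close>] by (simp add: Ldelta t)
      then show False using pos[of j] by (auto simp: s_pow_eq_1 dest: dvd_imp_le)
    qed
    have "i = j" using le[OF eq \<kappa> \<eta>] le[OF eq[symmetric] \<eta> \<kappa>] by simp
    moreover have "\<kappa> f = \<eta> f" for f
      using fun_cong[OF eq, of f] characters_nz[OF Lc, of j f] \<open>i = j\<close> by simp
    ultimately show "j = i \<and> \<kappa> = \<eta>" by auto
  qed
  have cardE: "card E = m * card K"
    unfolding E_def by (simp add: card_image[OF inj] card_cartesian_product)
  have E_per: "\<chi> \<in> periodic_characters N" if "\<chi> \<in> E" for \<chi>
    using that Lper Kc by (auto simp: E_def intro!: periodic_mult)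
  have \<rho>E: "\<rho> \<chi> \<in> K" if \<chi>: "\<chi> \<in> E" for \<chi>
  proof -
    obtain j \<kappa> where j: "\<kappa> \<in> K" "\<chi> = (\<lambda>f. L j f * \<kappa> f)" using \<chi> by (auto simp: E_def)
    have "\<rho> \<chi> f = 1" if f: "f \<in> val P" for f
    proof -
      have "\<kappa> (\<Psi> f) = 1" "\<kappa> f = 1" using j(1) f \<Psi>.F_val[OF f] by (auto simp: K_def)
      then show ?thesis using L\<Psi>[OF f, of j] characters_nz[OF Lc, of j f] by (simp add: \<rho>_def j(2))
    qed
    then show ?thesis using \<rho>_per[OF E_per[OF \<chi>]] by (simp add: K_def)
  qed
  \<comment> \<open>\<open>E\<close> has \<open>m * card K\<close> elements, so some fibre of
    \<open>\<rho>\<close> over \<open>K\<close> has at least \<open>m\<close>.\<close>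
  obtain \<kappa> where "\<kappa> \<in> K" and fib: "card (\<rho> -` {\<kappa>} \<inter> E) * card K \<ge> card E"
    using pigeonhole_card[of \<rho> E K] \<rho>E finE finK Kne by blast
  define Y where "Y = \<rho> -` {\<kappa>} \<inter> E"
  have "card K > 0" using finK Kne by (simp add: card_gt_0_iff)
  then have Y: "m \<le> card Y" using fib by (simp add: cardE Y_def)
  have finY: "finite Y" using finE by (simp add: Y_def)
  show ?thesis
  proof (cases "Y = {}")
    case True
    then show ?thesis using Y by (intro exI[of _ "{}"]) simp
  next
    case False
    then obtain \<eta> where \<eta>: "\<eta> \<in> Y" by blast
    have Yc: "\<chi> \<in> characters" if "\<chi> \<in> Y" for \<chi>
      using that E_per[of \<chi>] by (simp add: Y_def periodic_characters_def)
    \<comment> \<open>Characters of one fibre share their defect, so it cancels in the quotient by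
      the fixed \<open>\<eta>\<close>.\<close>
    define D where "D \<chi> = (\<lambda>f. \<chi> f / \<eta> f)" for \<chi> :: "((nat \<Rightarrow> int) \<Rightarrow> 'a) \<Rightarrow> complex"
    have "inj_on D Y"
    proof (rule inj_onI)
      fix \<chi> \<theta> assume "D \<chi> = D \<theta>"
      show "\<chi> = \<theta>"
      proof
        fix f show "\<chi> f = \<theta> f"
          using fun_cong[OF \<open>D \<chi> = D \<theta>\<close>, of f] characters_nz[OF Yc[OF \<eta>], of f] by (simp add: D_def)
      qed
    qed
    then have "card (D ` Y) = card Y" by (rule card_image)
    moreover have "D \<chi> \<in> {\<chi> \<in> characters. \<forall>f\<in>Sig. \<chi> (\<Psi> f) = \<chi> f}" if \<chi>: "\<chi> \<in> Y" for \<chi>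
    proof -
      have "\<rho> \<chi> = \<rho> \<eta>" using \<chi> \<eta> by (simp add: Y_def)
      have "D \<chi> (\<Psi> f) = D \<chi> f" if f: "f \<in> Sig" for f
      proof -
        have "\<chi> (\<Psi> f) / \<chi> f = \<eta> (\<Psi> f) / \<eta> f"
          using fun_cong[OF \<open>\<rho> \<chi> = \<rho> \<eta>\<close>, of f] f by (simp add: \<rho>_def)
        then show ?thesis
          using characters_nz[OF Yc[OF \<eta>], of f] characters_nz[OF Yc[OF \<eta>], of "\<Psi> f"] characters_nz[OF Yc[OF \<chi>], of f]
          by (simp add: D_def field_simps)
      qed
      then show ?thesis using characters_divide[OF Yc[OF \<chi>] Yc[OF \<eta>]] by (simp add: D_def)
    qed
    ultimately show ?thesis using finY Y by (intro exI[of _ "D ` Y"]) auto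
  qed
qed

end

section \<open>Automorphisms of the wreath product\<close>

context lamps
begin

abbreviation "W \<equiv> wreath_Zk G k"

lemma W_carrier: "(f, x) \<in> carrier W \<longleftrightarrow> f \<in> Sig \<and> x \<in> lattice k"
  by (auto simp: wreath_Zk_def Sig_def)

lemma W_mult: "(f, x) \<otimes>\<^bsub>W\<^esub> (g, y) = (f \<odot> shift x g, x + y)"
  by (simp add: wreath_Zk_def mulf_def shift_def fun_diff_def plus_fun_def)

lemma W_one: "\<one>\<^bsub>W\<^esub> = (onef, 0)"
  by (simp add: wreath_Zk_def onef_def zero_fun_def)

lemma W_group: "Group.group W"
proof (rule groupI)
  show "a \<otimes>\<^bsub>W\<^esub> b \<in> carrier W" if "a \<in> carrier W" "b \<in> carrier W" for a b
    using that by (cases a; cases b) (simp add: W_carrier W_mult)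
  show "\<one>\<^bsub>W\<^esub> \<in> carrier W" by (simp add: W_carrier W_one)
  show "a \<otimes>\<^bsub>W\<^esub> b \<otimes>\<^bsub>W\<^esub> c = a \<otimes>\<^bsub>W\<^esub> (b \<otimes>\<^bsub>W\<^esub> c)"
    if "a \<in> carrier W" "b \<in> carrier W" "c \<in> carrier W" for a b c
  proof -
    obtain f x g y h z where abc: "a = (f, x)" "b = (g, y)" "c = (h, z)" by (metis surj_pair)
    then have "f u \<in> carrier G" "g u \<in> carrier G" "h u \<in> carrier G" for u
      using that by (auto simp: W_carrier Sig_carrier)
    then have "f \<odot> shift x g \<odot> shift (x + y) h = f \<odot> shift x (g \<odot> shift y h)"
      unfolding shift_mulf shift_shift by (intro ext) (simp add: mulf_def shift_def G.m_assoc)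
    then show ?thesis by (simp add: abc W_mult add.assoc)
  qed
  show "\<one>\<^bsub>W\<^esub> \<otimes>\<^bsub>W\<^esub> a = a" if "a \<in> carrier W" for a
    using that by (cases a) (simp add: W_carrier W_mult W_one)
  show "\<exists>b\<in>carrier W. b \<otimes>\<^bsub>W\<^esub> a = \<one>\<^bsub>W\<^esub>" if "a \<in> carrier W" for a
  proof -
    obtain f x where a: "a = (f, x)" "f \<in> Sig" "x \<in> lattice k" using \<open>a \<in> carrier W\<close> W_carrier by (cases a) blast
    define h where "h = (\<lambda>z. inv (f z))"
    have fG: "f z \<in> carrier G" for z using a(2) by (rule Sig_carrier)
    have "h \<in> Sig" using a(2) unfolding Sig_def h_def by simp
    have "shift (- x) h \<odot> shift (- x) f = onef"
      by (rule ext) (simp add: mulf_def shift_def h_def onef_def fG)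
    then show ?thesis using \<open>h \<in> Sig\<close> a
      by (intro bexI[of _ "(shift (- x) h, - x)"]) (simp_all add: W_mult W_one W_carrier)
  qed
qed

section \<open>The maps induced on the base group and on the quotient lattice\<close>

definition base_map :: "(((nat \<Rightarrow> int) \<Rightarrow> 'a) \<times> (nat \<Rightarrow> int) \<Rightarrow> ((nat \<Rightarrow> int) \<Rightarrow> 'a) \<times> (nat \<Rightarrow> int)) \<Rightarrow> ((nat \<Rightarrow> int) \<Rightarrow> 'a) \<Rightarrow> (nat \<Rightarrow> int) \<Rightarrow> 'a" where
  "base_map \<phi> f = fst (\<phi> (f, 0))"

definition top_map :: "(((nat \<Rightarrow> int) \<Rightarrow> 'a) \<times> (nat \<Rightarrow> int) \<Rightarrow> ((nat \<Rightarrow> int) \<Rightarrow> 'a) \<times> (nat \<Rightarrow> int)) \<Rightarrow> (nat \<Rightarrow> int) \<Rightarrow> (nat \<Rightarrow> int)" where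
  "top_map \<phi> x = snd (\<phi> (onef, x))"

text \<open>The order of \<open>G\<close> kills \<open>(f, 0)\<close>, while integer vectors have no
  torsion; hence the second component of the image is 0.\<close>

lemma hom_W_torsion:
  assumes \<phi>: "\<phi> \<in> hom W W" and f: "f \<in> Sig"
  shows "\<phi> (f, 0) = (base_map \<phi> f, 0)" "base_map \<phi> f \<in> Sig"
proof -
  interpret W: Group.group W by (rule W_group)
  interpret \<phi>: group_hom W W \<phi> using \<phi> by unfold_locales
  have fW: "(f, 0) \<in> carrier W" using f by (simp add: W_carrier)
  define n where "n = Coset.order G"
  have pow1: "(f, 0) [^]\<^bsub>W\<^esub> i = (powf f i, 0)" for i :: nat
    by (induction i) (simp_all add: W_one W_mult powf_0 powf_Suc)
  have "powf f n = onef"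
    using Sig_carrier[OF f] by (simp add: powf_def onef_def G.pow_order_eq_1 n_def)
  then have "\<phi> (f, 0) [^]\<^bsub>W\<^esub> n = \<one>\<^bsub>W\<^esub>"
    using \<phi>.hom_nat_pow[OF fW, of n] by (simp add: pow1 flip: W_one)
  moreover have pow2: "snd (a [^]\<^bsub>W\<^esub> i) = smul (int i) (snd a)" for a and i :: nat
  proof (induction i)
    case 0
    have "smul 0 y = 0" for y by (rule ext) (simp add: pointwise)
    then show ?case by (simp add: W_one)
  next
    case (Suc i)
    have "snd (a \<otimes>\<^bsub>W\<^esub> b) = snd a + snd b" for a b by (cases a; cases b) (simp add: W_mult)
    moreover have "smul (int i) y + y = smul (int (Suc i)) y" for y
      by (rule ext) (simp add: pointwise algebra_simps)
    ultimately show ?case using Suc by simp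
  qed
  ultimately have e: "smul (int n) (snd (\<phi> (f, 0))) = 0"
    using pow2[of "\<phi> (f, 0)" n] by (simp add: W_one)
  have "int n * snd (\<phi> (f, 0)) i = 0" for i
    using fun_cong[OF e, of i] by (simp only: pointwise)
  then have "snd (\<phi> (f, 0)) i = 0 i" for i
    using order_pos by (simp add: pointwise n_def)
  then have "snd (\<phi> (f, 0)) = 0" by (rule ext)
  then show "\<phi> (f, 0) = (base_map \<phi> f, 0)" by (simp add: base_map_def prod_eq_iff)
  then show "base_map \<phi> f \<in> Sig" using \<phi>.hom_closed[OF fW] by (simp add: W_carrier)
qed

lemma hom_W_snd:
  assumes \<phi>: "\<phi> \<in> hom W W" and f: "f \<in> Sig" and x: "x \<in> lattice k"
  obtains h where "h \<in> Sig" "top_map \<phi> x \<in> lattice k" "\<phi> (onef, x) = (h, top_map \<phi> x)" "\<phi> (f, x) = (base_map \<phi> f \<odot> h, top_map \<phi> x)"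
proof -
  interpret W: Group.group W by (rule W_group)
  interpret \<phi>: group_hom W W \<phi> using \<phi> by unfold_locales
  define h where "h = fst (\<phi> (onef, x))"
  have e: "\<phi> (onef, x) = (h, top_map \<phi> x)" by (simp add: h_def top_map_def)
  have xW: "(onef, x) \<in> carrier W" "(f, 0) \<in> carrier W" using f x by (simp_all add: W_carrier)
  have "(f, x) = (f, 0) \<otimes>\<^bsub>W\<^esub> (onef, x)" using f by (simp add: W_mult)
  then have "\<phi> (f, x) = (base_map \<phi> f, 0) \<otimes>\<^bsub>W\<^esub> (h, top_map \<phi> x)"
    using \<phi>.hom_mult[OF xW(2,1)] by (simp add: e hom_W_torsion[OF \<phi> f])
  then show thesis
    using that[of h] e \<phi>.hom_closed[OF xW(1)] by (simp add: W_mult W_carrier)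
qed

lemma hom_W_lamps_map:
  assumes \<phi>: "\<phi> \<in> hom W W"
  shows "lamps_map G k (top_map \<phi>) (base_map \<phi>)"
proof
  interpret W: Group.group W by (rule W_group)
  interpret \<phi>: group_hom W W \<phi> using \<phi> by unfold_locales
  show A: "top_map \<phi> x \<in> lattice k" if "x \<in> lattice k" for x
    by (rule hom_W_snd[OF \<phi> onef_Sig that])
  show "top_map \<phi> (x + y) = top_map \<phi> x + top_map \<phi> y" if xy: "x \<in> lattice k" "y \<in> lattice k" for x y
  proof -
    have sh: "shift x onef = onef" by (simp add: shift_def onef_def)
    have "\<phi> (onef, x + y) = \<phi> (onef, x) \<otimes>\<^bsub>W\<^esub> \<phi> (onef, y)"
      using \<phi>.hom_mult[of "(onef, x)" "(onef, y)"] xy by (simp add: W_carrier W_mult sh)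
    then show ?thesis by (cases "\<phi> (onef, x)"; cases "\<phi> (onef, y)") (simp add: top_map_def W_mult)
  qed
  show "base_map \<phi> f \<in> Sig" if "f \<in> Sig" for f using hom_W_torsion(2)[OF \<phi> that] .
  show "base_map \<phi> (f \<odot> g) = base_map \<phi> f \<odot> base_map \<phi> g" if fg: "f \<in> Sig" "g \<in> Sig" for f g
    using \<phi>.hom_mult[of "(f, 0)" "(g, 0)"] fg
    by (simp add: W_carrier W_mult hom_W_torsion(1)[OF \<phi>])
  show "base_map \<phi> (shift x f) = shift (top_map \<phi> x) (base_map \<phi> f)" if x: "x \<in> lattice k" and f: "f \<in> Sig" for x f
  proof (rule hom_W_snd[OF \<phi> shift_Sig[OF x f] x])
    fix h assume h: "h \<in> Sig" "top_map \<phi> x \<in> lattice k" "\<phi> (onef, x) = (h, top_map \<phi> x)"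
      "\<phi> (shift x f, x) = (base_map \<phi> (shift x f) \<odot> h, top_map \<phi> x)"
    \<comment> \<open>The same element is also \<open>(shift x f, 0)\<close> times
      \<open>(onef, x)\<close>. Comparing both images and cancelling \<open>h\<close> in the abelian
      group \<open>Sig\<close> gives semilinearity.\<close>
    have "(shift x f, x) = (onef, x) \<otimes>\<^bsub>W\<^esub> (f, 0)" using x f by (simp add: W_mult)
    then have "\<phi> (shift x f, x) = (h, top_map \<phi> x) \<otimes>\<^bsub>W\<^esub> (base_map \<phi> f, 0)"
      using \<phi>.hom_mult[of "(onef, x)" "(f, 0)"] x f by (simp add: W_carrier h(3) hom_W_torsion(1)[OF \<phi>])
    then have "base_map \<phi> (shift x f) \<odot> h = h \<odot> shift (top_map \<phi> x) (base_map \<phi> f)"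
      using h(4) by (simp add: W_mult)
    then show ?thesis
      using h(1,2) x f hom_W_torsion(2)[OF \<phi>]
        mulf_commute[of h "shift (top_map \<phi> x) (base_map \<phi> f)"] mulf_cancel[of "base_map \<phi> (shift x f)" "shift (top_map \<phi> x) (base_map \<phi> f)" h]
      by simp
  qed
qed

lemma iso_W_inverse:
  assumes \<phi>: "\<phi> \<in> iso W W"
  shows "\<exists>\<phi>'\<in>iso W W. \<forall>a\<in>carrier W. \<phi>' (\<phi> a) = a \<and> \<phi> (\<phi>' a) = a"
proof
  interpret W: Group.group W by (rule W_group)
  have b: "bij_betw \<phi> (carrier W) (carrier W)" using \<phi> by (simp add: iso_def)
  show "inv_into (carrier W) \<phi> \<in> iso W W" using W.iso_set_sym \<phi> by blast
  show "\<forall>a\<in>carrier W. inv_into (carrier W) \<phi> (\<phi> a) = a \<and> \<phi> (inv_into (carrier W) \<phi> a) = a"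
    using bij_betw_inv_into_left[OF b] bij_betw_inv_into_right[OF b] by blast
qed

lemma hom_W_inverse:
  assumes \<phi>: "\<phi> \<in> hom W W" and \<psi>: "\<psi> \<in> hom W W" and inv: "\<And>a. a \<in> carrier W \<Longrightarrow> \<psi> (\<phi> a) = a"
  shows "f \<in> Sig \<Longrightarrow> base_map \<psi> (base_map \<phi> f) = f" "x \<in> lattice k \<Longrightarrow> top_map \<psi> (top_map \<phi> x) = x"
proof -
  assume f: "f \<in> Sig"
  have "\<psi> (\<phi> (f, 0)) = (f, 0)" using inv f by (simp add: W_carrier)
  then show "base_map \<psi> (base_map \<phi> f) = f" using f by (simp add: hom_W_torsion[OF \<phi>] hom_W_torsion(1)[OF \<psi>])
next
  assume x: "x \<in> lattice k"
  show "top_map \<psi> (top_map \<phi> x) = x"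
  proof (rule hom_W_snd[OF \<phi> onef_Sig x])
    fix h assume h: "h \<in> Sig" "top_map \<phi> x \<in> lattice k" "\<phi> (onef, x) = (h, top_map \<phi> x)"
    have "\<psi> (h, top_map \<phi> x) = (onef, x)" using inv[of "(onef, x)"] x h(3) by (simp add: W_carrier)
    then show ?thesis by (rule_tac hom_W_snd[OF \<psi> h(1,2)]) simp
  qed
qed

text \<open>The conjugacy equation is stated with its inverse cleared, so that it can be read off
  componentwise.\<close>

lemma class_eqD:
  assumes \<phi>: "\<phi> \<in> hom W W" and a: "a \<in> carrier W" and b: "b \<in> carrier W"
    and eq: "twisted_conj W \<phi> `` {a} = twisted_conj W \<phi> `` {b}"
  obtains g where "g \<in> carrier W" "b \<otimes>\<^bsub>W\<^esub> \<phi> g = g \<otimes>\<^bsub>W\<^esub> a"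
proof -
  interpret W: Group.group W by (rule W_group)
  interpret \<phi>: group_hom W W \<phi> using \<phi> by unfold_locales
  have "b = \<one>\<^bsub>W\<^esub> \<otimes>\<^bsub>W\<^esub> b \<otimes>\<^bsub>W\<^esub> inv\<^bsub>W\<^esub> (\<phi> \<one>\<^bsub>W\<^esub>)" using b by simp
  then have "(b, b) \<in> twisted_conj W \<phi>" unfolding twisted_conj_def using b W.one_closed by blast
  then have "(a, b) \<in> twisted_conj W \<phi>" using eq by blast
  then obtain g where g: "g \<in> carrier W" "b = g \<otimes>\<^bsub>W\<^esub> a \<otimes>\<^bsub>W\<^esub> inv\<^bsub>W\<^esub> (\<phi> g)"
    by (auto simp: twisted_conj_def)
  have "b \<otimes>\<^bsub>W\<^esub> \<phi> g = g \<otimes>\<^bsub>W\<^esub> a"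
    unfolding g(2) using g(1) a by (simp add: W.m_assoc)
  then show thesis using that g by blast
qed

text \<open>Among the \<open>M + 1\<close> multiples of \<open>v\<close> by
  \<open>0, ..., M\<close>, two are twisted conjugate. Their difference, a multiple of
  \<open>v\<close> by at most \<open>M\<close>, is in the image of \<open>1 - A\<close>, and
  \<open>inj_of_torsion_cokernel\<close> applies.\<close>

lemma finite_classes_imp_fixed_zero:
  assumes \<phi>: "\<phi> \<in> hom W W" and fin: "finite (reidemeister_classes W \<phi>)"
    and x: "x \<in> lattice k" "top_map \<phi> x = x"
  shows "x = 0"
proof -
  interpret lamps_map G k "top_map \<phi>" "base_map \<phi>" by (rule hom_W_lamps_map[OF \<phi>])
  define M where "M = card (reidemeister_classes W \<phi>)"
  have "\<exists>D\<in>{1..M}. \<exists>y\<in>lattice k. smul (int D) v = y - top_map \<phi> y" if v: "v \<in> lattice k" for v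
  proof -
    define cl where "cl i = twisted_conj W \<phi> `` {(onef, smul (int i) v)}" for i :: nat
    have vW: "(onef, smul (int i) v) \<in> carrier W" for i :: nat using v by (simp add: W_carrier)
    have "cl ` {..M} \<subseteq> reidemeister_classes W \<phi>"
      using vW by (auto simp: cl_def reidemeister_classes_def intro: quotientI)
    then have "card (cl ` {..M}) \<le> M" using card_mono[OF fin] by (simp add: M_def)
    then have "\<not> inj_on cl {..M}" by (intro pigeonhole) simp
    then obtain i j where ij: "i < j" "j \<le> M" "cl i = cl j"
      unfolding inj_on_def by (metis atMost_iff linorder_neqE_nat)
    obtain g where g: "g \<in> carrier W"
      "(onef, smul (int j) v) \<otimes>\<^bsub>W\<^esub> \<phi> g = g \<otimes>\<^bsub>W\<^esub> (onef, smul (int i) v)"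
      using class_eqD[OF \<phi> vW vW ij(3)[unfolded cl_def]] .
    obtain f y where fy: "g = (f, y)" "f \<in> Sig" "y \<in> lattice k" using g(1) W_carrier by (cases g) blast
    have "snd (\<phi> g) = top_map \<phi> y"
      unfolding fy(1) by (rule hom_W_snd[OF \<phi> fy(2,3)]) simp
    then obtain h where "\<phi> g = (h, top_map \<phi> y)" by (cases "\<phi> g") simp
    then have e: "smul (int j) v + top_map \<phi> y = y + smul (int i) v" using g(2) by (simp add: fy W_mult)
    have "smul (int (j - i)) v = y - top_map \<phi> y"
    proof
      fix l
      show "smul (int (j - i)) v l = (y - top_map \<phi> y) l"
        using fun_cong[OF e, of l] ij(1) by (simp add: pointwise of_nat_diff left_diff_distrib)
    qed
    then show ?thesis using ij fy by (intro bexI[of _ "j - i"] bexI[of _ y]) auto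
  qed
  then show ?thesis using inj_of_torsion_cokernel x by blast
qed

end

text \<open>On the elements \<open>(f, - m)\<close>, invariant characters of \<open>\<Psi>\<close>
  are constant on twisted conjugacy classes. Finitely many classes would bound the number of such
  characters, contrary to \<open>many_invariant_characters\<close>.\<close>

lemma (in lamps_char) infinite_reidemeister_classes:
  assumes "k \<ge> 1" and q: "q = 2 \<or> q = 3 \<and> odd k" and \<phi>: "\<phi> \<in> iso W W"
  shows "infinite (reidemeister_classes W \<phi>)"
proof
  assume fin: "finite (reidemeister_classes W \<phi>)"
  obtain \<phi>' where \<phi>': "\<phi>' \<in> iso W W" "\<And>a. a \<in> carrier W \<Longrightarrow> \<phi>' (\<phi> a) = a" "\<And>a. a \<in> carrier W \<Longrightarrow> \<phi> (\<phi>' a) = a"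
    using iso_W_inverse[OF \<phi>] by blast
  have hom: "\<phi> \<in> hom W W" "\<phi>' \<in> hom W W" using \<phi> \<phi>' by (auto simp: iso_def)
  interpret F: lamps_map G k "top_map \<phi>" "base_map \<phi>" by (rule hom_W_lamps_map[OF hom(1)])
  interpret F': lamps_map G k "top_map \<phi>'" "base_map \<phi>'" by (rule hom_W_lamps_map[OF hom(2)])
  interpret lattice_auto k "top_map \<phi>" "top_map \<phi>'"
    using hom_W_inverse(2)[OF hom \<phi>'(2)] hom_W_inverse(2)[OF hom(2,1) \<phi>'(3)] by unfold_locales auto
  interpret lamps_char_auto G k \<tau> s q R "top_map \<phi>" "top_map \<phi>'" "base_map \<phi>" "base_map \<phi>'"
    using hom_W_inverse(1)[OF hom \<phi>'(2)] by unfold_locales auto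
  have fix0: "x = 0" if "x \<in> lattice k" "top_map \<phi> x = x" for x
    using finite_classes_imp_fixed_zero[OF hom(1) fin that] .
  show False
  proof (rule monomial)
    fix m c assume m: "m \<in> lattice k" and c: "0 < c" "c < q"
      and mono: "\<And>f x. f \<in> val P \<Longrightarrow> x \<in> lattice k \<Longrightarrow> \<tau> (base_map \<phi> f (top_map \<phi> x + m)) = \<tau> (f x) ^ c"
    \<comment> \<open>Conjugation by \<open>(onef, - m)\<close> after the automorphism removes the
      translation by \<open>m\<close> on the Ulm factor.\<close>
    define \<Psi> where "\<Psi> f = shift (- m) (base_map \<phi> f)" for f
    have \<Psi>: "lamps_map G k (top_map \<phi>) \<Psi>"
      using m by unfold_locales (simp_all add: \<Psi>_def F.F_mult F.F_shift shift_mulf shift_shift add.commute)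
    have \<tau>\<Psi>: "\<tau> (\<Psi> f (top_map \<phi> x)) = \<tau> (f x) ^ c" if "f \<in> val P" "x \<in> lattice k" for f x
      using mono[OF that] by (simp add: \<Psi>_def shift_def)
    \<comment> \<open>The bounds \<open>0 < c < q\<close> leave only 1 for \<open>q = 2\<close>, and
      1 or 2 for \<open>q = 3\<close>.\<close>
    have cq: "c = 1 \<and> q \<ge> 2 \<or> c = 2 \<and> q = 3 \<and> odd k" using c q by auto
    show False
    proof (rule ex_weights[OF assms(1) fix0 cq])
      fix M :: nat and v t assume wts: "M > 0" "\<And>j. t j \<in> lattice k"
        "\<And>x y j m. x \<in> lattice k \<Longrightarrow> y \<in> lattice k \<Longrightarrow> j < m \<Longrightarrow> cgr (int M ^ m) x y \<Longrightarrow> v j x = v j y"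
        "\<And>x j. x \<in> lattice k \<Longrightarrow> [c * v j (top_map \<phi> x) = v j x] (mod q)"
        "\<And>j. 0 < v j (t j)" "\<And>j. v j (t j) < q" "\<And>i j. i < j \<Longrightarrow> v i (t j) = 0"
      define C where "C = reidemeister_classes W \<phi>"
      \<comment> \<open>The second component \<open>- m\<close> makes left multiplication apply the
        shift that occurs in \<open>\<Psi>\<close>.\<close>
      define cl where "cl f = twisted_conj W \<phi> `` {(f, - m)}" for f
      have fW: "(f, - m) \<in> carrier W" if "f \<in> Sig" for f using that m by (simp add: W_carrier)
      \<comment> \<open>One character more than \<open>card_characters_le\<close> allows.\<close>
      have "\<exists>E. finite E \<and> Suc (Coset.order G ^ card C) \<le> card E
          \<and> E \<subseteq> {\<chi> \<in> characters. \<forall>f\<in>Sig. \<chi> (\<Psi> f) = \<chi> f}"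
        by (rule many_invariant_characters[where c = c and M = M and t = t and v = v, OF lattice_auto_axioms \<Psi>])
          (fact \<tau>\<Psi> wts)+
      then obtain E where E: "finite E" "Suc (Coset.order G ^ card C) \<le> card E"
        "E \<subseteq> {\<chi> \<in> characters. \<forall>f\<in>Sig. \<chi> (\<Psi> f) = \<chi> f}"
        by (elim exE conjE)
      have "card E \<le> Coset.order G ^ card C"
      proof (rule card_characters_le)
        show "finite C" using fin by (simp add: C_def)
        show "cl f \<in> C" if "f \<in> Sig" for f
          using fW[OF that] by (auto simp: cl_def C_def reidemeister_classes_def intro: quotientI)
        show "E \<subseteq> characters" using E(3) by blast
        fix \<chi> f f' assume \<chi>: "\<chi> \<in> E" and f: "f \<in> Sig" "f' \<in> Sig" "cl f = cl f'"
        have \<chi>c: "\<chi> \<in> characters" and \<chi>\<Psi>: "\<And>f. f \<in> Sig \<Longrightarrow> \<chi> (\<Psi> f) = \<chi> f" using E(3) \<chi> by auto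
        obtain a where a: "a \<in> carrier W" "(f', - m) \<otimes>\<^bsub>W\<^esub> \<phi> a = a \<otimes>\<^bsub>W\<^esub> (f, - m)"
          using class_eqD[OF hom(1) fW[OF f(1)] fW[OF f(2)] f(3)[unfolded cl_def]] .
        obtain g x where g: "a = (g, x)" "g \<in> Sig" "x \<in> lattice k" using a(1) W_carrier by (cases a) blast
        have "snd (\<phi> a) = top_map \<phi> x"
          unfolding g(1) by (rule hom_W_snd[OF hom(1) g(2,3)]) simp
        \<comment> \<open>The second components show that \<open>x\<close> is fixed, hence 0; so
          only elements of the base group conjugate here, and they give
          \<open>f' \<odot> \<Psi> g = g \<odot> f\<close>.\<close>
        then have "- m + top_map \<phi> x = x + - m"
          using a(2) by (cases "\<phi> a") (simp add: g W_mult)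
        then have "x = 0" using fix0[OF g(3)] by simp
        then have "f' \<odot> \<Psi> g = g \<odot> f"
          using a(2) g by (simp add: hom_W_torsion(1)[OF hom(1)] W_mult \<Psi>_def)
        then have "\<chi> f' * \<chi> (\<Psi> g) = \<chi> g * \<chi> f"
          using character_mult[OF charactersD(1)[OF \<chi>c]] f g lamps_map.F_closed[OF \<Psi>] by metis
        then show "\<chi> f = \<chi> f'" using \<chi>\<Psi>[OF g(2)] characters_nz[OF \<chi>c, of g] by simp
      qed
      then show False using E(2) by simp
    qed
  qed
qed

theorem theorem2:
  fixes G :: "('a, 'b) monoid_scheme" and k n i0 :: nat and p r d :: "nat \<Rightarrow> nat"
  assumes "comm_group G" and "finite (carrier G)" and "k \<ge> 1"
    and "\<forall>i<n. Factorial_Ring.prime (p i) \<and> r i \<ge> 1 \<and> d i \<ge> 1"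
    and "\<forall>i<n. \<forall>j<n. i \<noteq> j \<longrightarrow> (p i, r i) \<noteq> (p j, r j)"
    and "G \<cong> product_group {(i, j). i < n \<and> j < d i} (\<lambda>(i, j). integer_mod_group (p i ^ r i))"
    and "i0 < n" and "d i0 = 1"
    and "p i0 = 2 \<or> (p i0 = 3 \<and> odd k)"
  shows "R_infty (wreath_Zk G k)"
proof -
  obtain \<tau> :: "'a \<Rightarrow> complex" and s where "lamps_char G \<tau> s (p i0) (r i0)"
  proof (rule ulm_character[OF assms(1,2,4-8)])
    fix \<tau> :: "'a \<Rightarrow> complex" and s
    assume \<tau>: "\<And>g h. g \<in> carrier G \<Longrightarrow> h \<in> carrier G \<Longrightarrow> \<tau> (g \<otimes>\<^bsub>G\<^esub> h) = \<tau> g * \<tau> h"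
      "\<And>g. \<tau> g \<noteq> 0"
      "\<And>g. g \<in> ulm_set G (p i0) (r i0 - 1) \<Longrightarrow> \<tau> g = 1 \<Longrightarrow> g \<in> ulm_set G (p i0) (r i0)"
      "\<And>g. g \<in> ulm_set G (p i0) (r i0) \<Longrightarrow> \<tau> g = 1"
      "s \<in> ulm_set G (p i0) (r i0 - 1)" "\<tau> s = cis (2 * pi / p i0)"
    interpret comm_group G by fact
    have "lamps_char G \<tau> s (p i0) (r i0)"
      using assms(2,4,7) \<tau> by unfold_locales auto
    then show thesis by (rule that)
  qed
  then interpret lamps_char G k \<tau> s "p i0" "r i0" .
  show ?thesis
    unfolding R_infty_def using infinite_reidemeister_classes[OF assms(3,9)] by blast
qed

end
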